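(* Assume that $f_i$ is convex and $L$-smooth for all $i=1,\dots,n$ and $f$ is $\mu$-quasi strongly convex, $\mu\ge0$. Consider D-QSGDstar with delay $\tau\ge1$ and $$0<\gamma\le\min\left\{\frac1{4L\left(1+\frac\omega n\right)},\ \frac1{8L\sqrt{\tau\left(\tau+1+\frac\omega n\right)}}\right\}.$$ Then, with $D=\frac1n\sum_{i=1}^nD_i$, D-QSGDstar satisfies the parametric assumption of the context with $A'=L\left(1+\frac\omega n\right)$, $B_1'=B_2'=0$, $D_1'=\frac{(\omega+1)D}n$, $\sigma_{1,k}^2\equiv\sigma_{2,k}^2\equiv0$, $\rho_1=\rho_2=1$, $C_1=C_2=0$, $D_2=0$, $G=0$, $F_1=F_2=0$, $D_3=\frac{3\gamma\tau L(\omega+1)D}n$, and for all $K\ge0$ $$\mathbf E[f(\bar x^K)-f(x^* )]\le\left(1-\frac{\gamma\mu}2\right)^K\frac{4\|x^0-x^*\|^2}\gamma+4\gamma(D_1'+D_3)$$ when $\mu>0$, and $$\mathbf E[f(\bar x^K)-f(x^* )]\le\frac{4\|x^0-x^*\|^2}{\gamma K}+4\gamma(D_1'+D_3)$$ when $\mu=0$ (right-hand side read as $+\infty$ for $K=0$).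
   Context: $f(x)=\frac1n\sum_{i=1}^nf_i(x)$ on $\mathbb R^d$. A function is $L$-smooth if it is differentiable with $L$-Lipschitz gradient. $f$ is $\mu$-quasi strongly convex if it has a unique minimizer $x^*$ and $f(x^* )\ge f(x)+\langle\nabla f(x),x^*-x\rangle+\frac\mu2\|x-x^*\|^2$ for all $x$. $Q$ is a randomized quantization operator with $\mathbf E[Q(x)]=x$, $\mathbf E\|Q(x)-x\|^2\le\omega\|x\|^2$ for all $x$, $\omega>0$; applications use fresh independent randomness. Delayed framework with integer delay $\tau\ge1$: $x^{k+1}=x^k-\frac1n\sum_iv_i^k$, where $v_i^k=\gamma g_i^{k-\tau}$ if $k\ge\tau$ and $v_i^k=0$ if $k<\tau$; $e_i^{k+1}=e_i^k+\gamma g_i^k-v_i^k$, $e_i^0=0$; $x^0$ deterministic. Here $g_i^k$ is the stochastic vector associated with the point $x^k$. $\mathbf E_k$ is the conditional expectation given $x^k$ and all randomness used to generate $g_i^t$ for $t<k$. D-QSGDstar: for $k\ge0$ worker $i$ samples, independently of the other workers, $\hat g_i^k$ with $\mathbf E_k[\hat g_i^k]=\nabla f_i(x^k)$, $\mathbf E_k\|\hat g_i^k-\nabla f_i(x^k)\|^2\le D_i$ ($D_i\ge0$ constant), and sets $g_i^k=Q(\hat g_i^k-\nabla f_i(x^* ))$. Parametric assumption: let $g^k=\frac1n\sum_ig_i^k$, $e^k=\frac1n\sum_ie_i^k$. For all $k,K\ge0$: $\mathbf E_k[g^k]=\nabla f(x^k)$; $\mathbf E_k\|g^k\|^2\le2A'(f(x^k)-f(x^*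 ))+B_1'\sigma_{1,k}^2+B_2'\sigma_{2,k}^2+D_1'$; $\mathbf E_k[\sigma_{1,k+1}^2]\le(1-\rho_1)\sigma_{1,k}^2+2C_1(f(x^k)-f(x^* ))+G\rho_1\sigma_{2,k}^2+D_2$; $\mathbf E_k[\sigma_{2,k+1}^2]\le(1-\rho_2)\sigma_{2,k}^2+2C_2(f(x^k)-f(x^* ))$; $3L\sum_{k=0}^Kw_k\mathbf E\|e^k\|^2\le\frac14\sum_{k=0}^Kw_k\mathbf E[f(x^k)-f(x^* )]+F_1\sigma_{1,0}^2+F_2\sigma_{2,0}^2+\gamma D_3W_K$, where $w_k=(1-\eta)^{-(k+1)}$, $W_K=\sum_{k=0}^Kw_k$, $\eta=\min\{\frac{\gamma\mu}2,\frac{\rho_1}4,\frac{\rho_2}4\}$. Also $\bar x^K=\frac1{W_K}\sum_{k=0}^Kw_kx^k$. *)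

theory Defs
  imports "HOL-Probability.Probability"
begin

section \<open>Objective functions\<close>

definition grad :: "('a::euclidean_space \<Rightarrow> real) \<Rightarrow> 'a \<Rightarrow> 'a" where
  "grad h x = (THE d. GDERIV h x :> d)"

definition L_smooth :: "real \<Rightarrow> ('a::euclidean_space \<Rightarrow> real) \<Rightarrow> bool" where
  "L_smooth L h \<longleftrightarrow> (\<forall>x. h differentiable (at x)) \<and> L-lipschitz_on UNIV (grad h)"

definition quasi_strongly_convex :: "real \<Rightarrow> ('a::euclidean_space \<Rightarrow> real) \<Rightarrow> 'a \<Rightarrow> bool" where
  "quasi_strongly_convex \<mu> h xs \<longleftrightarrow>
     (\<forall>y. (\<forall>z. h y \<le> h z) \<longleftrightarrow> y = xs) \<and>
     (\<forall>x. h xs \<ge> h x + grad h x \<bullet> (xs - x) + \<mu> / 2 * (norm (x - xs))\<^sup>2)"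

definition mean_fun :: "nat \<Rightarrow> (nat \<Rightarrow> 'a \<Rightarrow> real) \<Rightarrow> 'a \<Rightarrow> real" where
  "mean_fun n h x = (\<Sum>i<n. h i x) / real n"

section \<open>Conditional expectation and conditional independence\<close>

text \<open>
  The library function \<open>real_cond_exp\<close> is real-valued only, so for vectors the defining property
  is spelled out: \<open>Y\<close> is a version of the conditional expectation of \<open>X\<close> given the
  sub-sigma-algebra \<open>F\<close>. Integrability is part of both notions below, because \<open>real_cond_exp\<close>
  and the Bochner integral return junk values on non-integrable functions.
\<close>

definition has_cond_exp ::
    "'w measure \<Rightarrow> 'w measure \<Rightarrow> ('w \<Rightarrow> 'a::euclidean_space) \<Rightarrow> ('w \<Rightarrow> 'a) \<Rightarrow> bool" where
  "has_cond_exp M F X Y \<longleftrightarrow>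
     integrable M X \<and> integrable M Y \<and> Y \<in> borel_measurable F \<and>
     (\<forall>A\<in>sets F. (LINT w:A|M. X w) = (LINT w:A|M. Y w))"

definition cond_exp_le ::
    "'w measure \<Rightarrow> 'w measure \<Rightarrow> ('w \<Rightarrow> real) \<Rightarrow> ('w \<Rightarrow> real) \<Rightarrow> bool" where
  "cond_exp_le M F X Y \<longleftrightarrow> integrable M X \<and> (AE w in M. real_cond_exp M F X w \<le> Y w)"

definition cond_indep_vars ::
    "'w measure \<Rightarrow> 'w measure \<Rightarrow> 'b measure \<Rightarrow> ('i \<Rightarrow> 'w \<Rightarrow> 'b) \<Rightarrow> 'i set \<Rightarrow> bool" where
  "cond_indep_vars M F N X I \<longleftrightarrow>
     (\<forall>i\<in>I. X i \<in> measurable M N) \<and>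
     (\<forall>J A. finite J \<and> J \<noteq> {} \<and> J \<subseteq> I \<and> (\<forall>i\<in>J. A i \<in> sets N) \<longrightarrow>
        (AE w in M. real_cond_exp M F (indicator {w \<in> space M. \<forall>i\<in>J. X i w \<in> A i}) w =
                    (\<Prod>i\<in>J. real_cond_exp M F (indicator {w \<in> space M. X i w \<in> A i}) w)))"

text \<open>The family of events generated by a random element of \<open>N\<close>.\<close>

abbreviation gen :: "'w measure \<Rightarrow> ('w \<Rightarrow> 'b) \<Rightarrow> 'b measure \<Rightarrow> 'w set set" where
  "gen M X N \<equiv> sets (vimage_algebra (space M) X N)"

section \<open>Quantization\<close>

text \<open>
  A randomized operator is a jointly measurable function of its input and of a random seed
  distributed according to the probability measure \<open>S\<close>.
\<close>

definition quantization_operator ::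
    "'s measure \<Rightarrow> real \<Rightarrow> ('a::euclidean_space \<Rightarrow> 's \<Rightarrow> 'a) \<Rightarrow> bool" where
  "quantization_operator S \<omega> Q \<longleftrightarrow>
     prob_space S \<and>
     case_prod Q \<in> measurable (borel \<Otimes>\<^sub>M S) borel \<and>
     (\<forall>x. integrable S (Q x) \<and> (LINT s|S. Q x s) = x) \<and>
     (\<forall>x. integrable S (\<lambda>s. (norm (Q x s - x))\<^sup>2) \<and>
          (LINT s|S. (norm (Q x s - x))\<^sup>2) \<le> \<omega> * (norm x)\<^sup>2)"

section \<open>The algorithm\<close>

text \<open>Worker-indexed families are written \<open>g i k w\<close> (worker \<open>i < n\<close>, step \<open>k\<close>, outcome \<open>w\<close>).\<close>

definition delayed_update ::
    "real \<Rightarrow> nat \<Rightarrow> (nat \<Rightarrow> nat \<Rightarrow> 'w \<Rightarrow> 'a::euclidean_space) \<Rightarrow> nat \<Rightarrow> nat \<Rightarrow> 'w \<Rightarrow> 'a" where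
  "delayed_update \<gamma> \<tau> g i k w = (if k \<ge> \<tau> then \<gamma> *\<^sub>R g i (k - \<tau>) w else 0)"

definition delayed_framework ::
    "nat \<Rightarrow> real \<Rightarrow> nat \<Rightarrow> 'a::euclidean_space \<Rightarrow> (nat \<Rightarrow> nat \<Rightarrow> 'w \<Rightarrow> 'a)
     \<Rightarrow> (nat \<Rightarrow> 'w \<Rightarrow> 'a) \<Rightarrow> (nat \<Rightarrow> nat \<Rightarrow> 'w \<Rightarrow> 'a) \<Rightarrow> bool" where
  "delayed_framework n \<gamma> \<tau> x0 g x e \<longleftrightarrow>
     (\<forall>w. x 0 w = x0) \<and>
     (\<forall>k w. x (Suc k) w = x k w - (1 / real n) *\<^sub>R (\<Sum>i<n. delayed_update \<gamma> \<tau> g i k w)) \<and>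
     (\<forall>i<n. \<forall>w. e i 0 w = 0) \<and>
     (\<forall>i<n. \<forall>k w. e i (Suc k) w = e i k w + \<gamma> *\<^sub>R g i k w - delayed_update \<gamma> \<tau> g i k w)"

text \<open>
  \<open>smp i t\<close> is the random element (valued in an arbitrary measurable space \<open>N\<close>) drawn by worker
  \<open>i\<close> at step \<open>t\<close> for its stochastic gradient, and \<open>seed i t\<close> the seed of the quantization;
  \<open>history\<close> is the sigma-algebra that the conditional expectation \<open>E\<^sub>k\<close> refers to.
\<close>

definition history ::
    "'w measure \<Rightarrow> 'z measure \<Rightarrow> 's measure \<Rightarrow> nat \<Rightarrow> (nat \<Rightarrow> nat \<Rightarrow> 'w \<Rightarrow> 'z)
     \<Rightarrow> (nat \<Rightarrow> nat \<Rightarrow> 'w \<Rightarrow> 's) \<Rightarrow> (nat \<Rightarrow> 'w \<Rightarrow> 'a::euclidean_space) \<Rightarrow> nat \<Rightarrow> 'w measure" where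
  "history M N S n smp seed x k = sigma (space M)
     (gen M (x k) borel \<union> (\<Union>t<k. \<Union>i<n. gen M (smp i t) N \<union> gen M (seed i t) S))"

text \<open>
  Given the past, the samples of the workers are conditionally independent, and the stochastic
  gradient of a worker is a function of the past and of its own sample. The seeds of step \<open>k\<close> are
  fresh: in the family of sigma-algebras indexed by \<open>{..n}\<close>, index \<open>0\<close> carries the past together
  with all samples of step \<open>k\<close>, index \<open>Suc i\<close> carries the seed of worker \<open>i\<close>.
\<close>

definition D_QSGDstar ::
    "'w measure \<Rightarrow> 'z measure \<Rightarrow> 's measure \<Rightarrow> nat \<Rightarrow> (nat \<Rightarrow> 'a::euclidean_space \<Rightarrow> real) \<Rightarrow> 'a
     \<Rightarrow> ('a \<Rightarrow> 's \<Rightarrow> 'a) \<Rightarrow> (nat \<Rightarrow> real) \<Rightarrow> real \<Rightarrow> nat \<Rightarrow> 'a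
     \<Rightarrow> (nat \<Rightarrow> nat \<Rightarrow> 'w \<Rightarrow> 'z) \<Rightarrow> (nat \<Rightarrow> nat \<Rightarrow> 'w \<Rightarrow> 's) \<Rightarrow> (nat \<Rightarrow> nat \<Rightarrow> 'w \<Rightarrow> 'a)
     \<Rightarrow> (nat \<Rightarrow> nat \<Rightarrow> 'w \<Rightarrow> 'a) \<Rightarrow> (nat \<Rightarrow> 'w \<Rightarrow> 'a) \<Rightarrow> (nat \<Rightarrow> nat \<Rightarrow> 'w \<Rightarrow> 'a) \<Rightarrow> bool" where
  "D_QSGDstar M N S n f xs Q Dw \<gamma> \<tau> x0 smp seed ghat g x e \<longleftrightarrow>
     prob_space M \<and>
     delayed_framework n \<gamma> \<tau> x0 g x e \<and>
     (\<forall>i<n. \<forall>k w. g i k w = Q (ghat i k w - grad (f i) xs) (seed i k w)) \<and>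
     (\<forall>k. let F = history M N S n smp seed x k in
        cond_indep_vars M F N (\<lambda>i. smp i k) {..<n} \<and>
        (\<forall>i<n. ghat i k \<in> borel_measurable (sigma (space M) (sets F \<union> gen M (smp i k) N)) \<and>
               has_cond_exp M F (ghat i k) (\<lambda>w. grad (f i) (x k w)) \<and>
               cond_exp_le M F (\<lambda>w. (norm (ghat i k w - grad (f i) (x k w)))\<^sup>2) (\<lambda>w. Dw i)) \<and>
        (\<forall>i<n. seed i k \<in> measurable M S \<and> distr M S (seed i k) = S) \<and>
        prob_space.indep_sets M
          (case_nat (sigma_sets (space M) (sets F \<union> (\<Union>i<n. gen M (smp i k) N)))
                    (\<lambda>i. gen M (seed i k) S)) {..n})"

section \<open>The parametric assumption\<close>

definition wgt :: "real \<Rightarrow> nat \<Rightarrow> real" where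
  "wgt \<eta> k = 1 / (1 - \<eta>) ^ (k + 1)"

definition Wgt :: "real \<Rightarrow> nat \<Rightarrow> real" where
  "Wgt \<eta> K = (\<Sum>k\<le>K. wgt \<eta> k)"

definition weighted_avg :: "real \<Rightarrow> (nat \<Rightarrow> 'w \<Rightarrow> 'a::real_vector) \<Rightarrow> nat \<Rightarrow> 'w \<Rightarrow> 'a" where
  "weighted_avg \<eta> x K w = (1 / Wgt \<eta> K) *\<^sub>R (\<Sum>k\<le>K. wgt \<eta> k *\<^sub>R x k w)"

record par_consts =
  cA :: real
  cB1 :: real
  cB2 :: real
  cD1 :: real
  cC1 :: real
  cC2 :: real
  cG :: real
  cD2 :: real
  crho1 :: real
  crho2 :: real
  cF1 :: real
  cF2 :: real
  cD3 :: real

definition par_eta :: "par_consts \<Rightarrow> real \<Rightarrow> real \<Rightarrow> real" where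
  "par_eta c \<gamma> \<mu> = Min {\<gamma> * \<mu> / 2, crho1 c / 4, crho2 c / 4}"

text \<open>
  \<open>cA\<close>, \<open>cB1\<close>, \<open>cB2\<close>, \<open>cD1\<close> are the primed constants of the second-moment bound; \<open>h\<close> is the mean
  objective, \<open>gm\<close> and \<open>em\<close> are the worker averages of the stochastic vectors and of the errors.
\<close>

definition parametric_assumption ::
    "'w measure \<Rightarrow> (nat \<Rightarrow> 'w measure) \<Rightarrow> ('a::euclidean_space \<Rightarrow> real) \<Rightarrow> 'a \<Rightarrow> real \<Rightarrow> real \<Rightarrow> real
     \<Rightarrow> (nat \<Rightarrow> 'w \<Rightarrow> 'a) \<Rightarrow> (nat \<Rightarrow> 'w \<Rightarrow> 'a) \<Rightarrow> (nat \<Rightarrow> 'w \<Rightarrow> 'a)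
     \<Rightarrow> (nat \<Rightarrow> 'w \<Rightarrow> real) \<Rightarrow> (nat \<Rightarrow> 'w \<Rightarrow> real) \<Rightarrow> par_consts \<Rightarrow> bool" where
  "parametric_assumption M F h xs L \<mu> \<gamma> x gm em \<sigma>1 \<sigma>2 c \<longleftrightarrow>
     (\<forall>k. has_cond_exp M (F k) (gm k) (\<lambda>w. grad h (x k w))) \<and>
     (\<forall>k. cond_exp_le M (F k) (\<lambda>w. (norm (gm k w))\<^sup>2)
        (\<lambda>w. 2 * cA c * (h (x k w) - h xs) + cB1 c * (\<sigma>1 k w)\<^sup>2 + cB2 c * (\<sigma>2 k w)\<^sup>2 + cD1 c)) \<and>
     (\<forall>k. cond_exp_le M (F k) (\<lambda>w. (\<sigma>1 (k + 1) w)\<^sup>2)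
        (\<lambda>w. (1 - crho1 c) * (\<sigma>1 k w)\<^sup>2 + 2 * cC1 c * (h (x k w) - h xs)
             + cG c * crho1 c * (\<sigma>2 k w)\<^sup>2 + cD2 c)) \<and>
     (\<forall>k. cond_exp_le M (F k) (\<lambda>w. (\<sigma>2 (k + 1) w)\<^sup>2)
        (\<lambda>w. (1 - crho2 c) * (\<sigma>2 k w)\<^sup>2 + 2 * cC2 c * (h (x k w) - h xs))) \<and>
     (\<forall>k. integrable M (\<lambda>w. (norm (em k w))\<^sup>2) \<and> integrable M (\<lambda>w. h (x k w) - h xs)) \<and>
     (let \<eta> = par_eta c \<gamma> \<mu> in
      \<forall>K. AE w0 in M.
        3 * L * (\<Sum>k\<le>K. wgt \<eta> k * (LINT w|M. (norm (em k w))\<^sup>2))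
        \<le> 1 / 4 * (\<Sum>k\<le>K. wgt \<eta> k * (LINT w|M. h (x k w) - h xs))
          + cF1 c * (\<sigma>1 0 w0)\<^sup>2 + cF2 c * (\<sigma>2 0 w0)\<^sup>2 + \<gamma> * cD3 c * Wgt \<eta> K)"

end

theory Submission
  imports Defs
begin

text \<open>
  The corrected iterate \<open>x k - e k\<close>, with \<open>e k\<close> the averaged error, makes the undelayed step
  \<open>- \<gamma> *\<^sub>R g k\<close> (\<open>x_minus_em\<close>), where \<open>g k\<close> is computed at \<open>x k\<close>. Expanding its squared distance to
  the minimizer, with quasi strong convexity and \<open>\<mu> \<le> L\<close>, gives a contraction by \<open>1 - \<gamma> * \<mu> / 2\<close> up to
  the terms \<open>3 * L * \<gamma> * E (norm (e k))\<^sup>2\<close> and \<open>\<gamma>\<^sup>2 * D1'\<close>, against a gain of \<open>\<gamma> / 2\<close> times the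
  expected gap (\<open>descent_step\<close>). The weights make this telescope, half of the gain absorbs the error
  term, and convexity passes from the weighted mean of the gaps to the gap at the weighted mean.

  Two second moments remain to be bounded.

  The noise of \<open>g k\<close> is the mean of the sampling and quantization errors of the workers. They are
  pairwise orthogonal on every event of the past: a quantization error is centered given everything
  but its own seed (\<open>quantization_error\<close>), and the sampling errors are conditionally independent
  (\<open>cond_indep_centered\<close>). Adding the co-coercivity bound \<open>sum_grad_diff_le\<close> for the inputs of the
  quantizer yields \<open>noise_second_moment\<close> and \<open>gm_second_moment\<close>.

  The error \<open>e k\<close> is \<open>\<gamma>\<close> times the sum of the last \<open>\<tau>\<close> stochastic vectors. Its variance part must
  enter with constant exactly \<open>1\<close>, since \<open>D3\<close> leaves no room for more, and it does: through the
  delay, all points at which these vectors are computed are determined before the first of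
  them is drawn, so that gradients and noises in the window are orthogonal (\<open>em_second_moment\<close>).
  The step size keeps the growth of the weights over such a window below a factor \<open>2\<close>.

  All conditional statements are reduced to integrals over events of a sub-sigma-algebra;
  \<open>centered\<close> says that these integrals vanish, and orthogonality to square-integrable vectors
  that are measurable for the sub-sigma-algebra follows (\<open>centered_orthogonal\<close>).
\<close>

section \<open>Smooth convex functions\<close>

lemma grad_eqI:
  fixes h :: "'a::euclidean_space \<Rightarrow> real"
  assumes "GDERIV h x :> d"
  shows "grad h x = d"
  unfolding grad_def
proof (rule the_equality)
  show "GDERIV h x :> d" by (rule assms)
next
  fix d' assume "GDERIV h x :> d'"
  then have "(\<lambda>v. v \<bullet> d') = (\<lambda>v. v \<bullet> d)"
    using assms unfolding gderiv_def by (rule has_derivative_unique)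
  then show "d' = d"
    unfolding fun_eq_iff vector_eq_ldot .
qed

lemma GDERIV_grad:
  fixes h :: "'a::euclidean_space \<Rightarrow> real"
  assumes "h differentiable (at x)"
  shows "GDERIV h x :> grad h x"
proof -
  obtain D where D: "(h has_derivative D) (at x)"
    using assms unfolding differentiable_def by blast
  have "D = (\<lambda>v. v \<bullet> adjoint D 1)"
    using adjoint_works[OF has_derivative_linear[OF D]] by fastforce
  then have "GDERIV h x :> adjoint D 1"
    using D unfolding gderiv_def by simp
  then show ?thesis
    using grad_eqI[of h x] by simp
qed

lemma grad_eq_0_at_minimum:
  fixes h :: "'a::euclidean_space \<Rightarrow> real"
  assumes "h differentiable (at x)" and "\<And>y. h x \<le> h y"
  shows "grad h x = 0"
proof -
  have "(\<lambda>v. v \<bullet> grad h x) = (\<lambda>v. 0)"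
    using GDERIV_grad[OF assms(1)] assms(2) unfolding gderiv_def
    by (intro differential_zero_maxmin[where f = h and S = UNIV and x = x]) auto
  then have "grad h x \<bullet> grad h x = 0"
    by (rule fun_cong)
  then show ?thesis by simp
qed

lemma DERIV_along_line:
  fixes h :: "'a::euclidean_space \<Rightarrow> real"
  assumes "\<And>y. h differentiable (at y)"
  shows "((\<lambda>t. h (x + t *\<^sub>R v)) has_real_derivative (grad h (x + t *\<^sub>R v) \<bullet> v)) (at t)"
proof -
  have "(h has_derivative (\<lambda>u. u \<bullet> grad h (x + t *\<^sub>R v))) (at (x + t *\<^sub>R v))"
    using GDERIV_grad[OF assms] unfolding gderiv_def .
  moreover have "((\<lambda>t. x + t *\<^sub>R v) has_derivative (\<lambda>s. s *\<^sub>R v)) (at t)"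
    by (auto intro!: derivative_eq_intros)
  ultimately have "((\<lambda>t. h (x + t *\<^sub>R v)) has_derivative (\<lambda>s. (s *\<^sub>R v) \<bullet> grad h (x + t *\<^sub>R v))) (at t)"
    using has_derivative_compose by fastforce
  then show ?thesis
    unfolding has_field_derivative_def
    by (rule has_derivative_eq_rhs) (auto simp: inner_commute)
qed

lemma L_smooth_nonneg: "L_smooth L h \<Longrightarrow> 0 \<le> L"
  unfolding L_smooth_def lipschitz_on_def by blast

lemma L_smooth_grad_le: "L_smooth L h \<Longrightarrow> norm (grad h x - grad h y) \<le> L * norm (x - y)"
  unfolding L_smooth_def by (metis UNIV_I dist_norm lipschitz_onD)

lemma descent_inequality:
  fixes h :: "'a::euclidean_space \<Rightarrow> real"
  assumes L: "L_smooth L h"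
  shows "h y \<le> h x + grad h x \<bullet> (y - x) + L / 2 * (norm (y - x))\<^sup>2"
proof -
  define v where "v = y - x"
  define \<psi> where "\<psi> t = h (x + t *\<^sub>R v) - t * (grad h x \<bullet> v) - L / 2 * t\<^sup>2 * (norm v)\<^sup>2" for t
  define \<psi>' where "\<psi>' t = grad h (x + t *\<^sub>R v) \<bullet> v - grad h x \<bullet> v - L * t * (norm v)\<^sup>2" for t
  have diff: "\<And>y. h differentiable (at y)"
    using L unfolding L_smooth_def by blast
  have der: "(\<psi> has_real_derivative \<psi>' t) (at t)" for t
    unfolding \<psi>_def \<psi>'_def
    by (rule derivative_eq_intros DERIV_along_line[OF diff] refl)+ simp
  have neg: "\<psi>' t \<le> 0" if "0 \<le> t" for t
  proof -
    have "grad h (x + t *\<^sub>R v) \<bullet> v - grad h x \<bullet> v = (grad h (x + t *\<^sub>R v) - grad h x) \<bullet> v"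
      by (simp add: inner_diff_left)
    also have "\<dots> \<le> norm (grad h (x + t *\<^sub>R v) - grad h x) * norm v"
      by (rule norm_cauchy_schwarz)
    also have "\<dots> \<le> L * norm (t *\<^sub>R v) * norm v"
      using L_smooth_grad_le[OF L, of "x + t *\<^sub>R v" x] by (intro mult_right_mono) auto
    also have "\<dots> = L * t * (norm v)\<^sup>2"
      using that by (simp add: power2_eq_square)
    finally show ?thesis unfolding \<psi>'_def by simp
  qed
  have "\<psi> 1 \<le> \<psi> 0"
    using der neg by (intro DERIV_nonpos_imp_nonincreasing[of 0 1 \<psi>]) auto
  then show ?thesis unfolding \<psi>_def v_def by simp
qed

lemma convex_above_tangent:
  fixes h :: "'a::euclidean_space \<Rightarrow> real"
  assumes conv: "convex_on UNIV h" and diff: "\<And>y. h differentiable (at y)"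
  shows "h y \<ge> h x + grad h x \<bullet> (y - x)"
proof -
  define \<phi> where "\<phi> t = h (x + t *\<^sub>R (y - x))" for t :: real
  have "convex_on UNIV \<phi>"
  proof (rule convex_onI)
    fix t a b :: real assume "0 < t" "t < 1"
    have "x + ((1 - t) *\<^sub>R a + t *\<^sub>R b) *\<^sub>R (y - x)
        = (1 - t) *\<^sub>R (x + a *\<^sub>R (y - x)) + t *\<^sub>R (x + b *\<^sub>R (y - x))"
      by (simp add: algebra_simps)
    then show "\<phi> ((1 - t) *\<^sub>R a + t *\<^sub>R b) \<le> (1 - t) * \<phi> a + t * \<phi> b"
      using convex_onD[OF conv, of t] \<open>0 < t\<close> \<open>t < 1\<close> unfolding \<phi>_def by simp
  qed simp
  moreover have "(\<phi> has_real_derivative grad h x \<bullet> (y - x)) (at 0)"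
    using DERIV_along_line[OF diff, of x "y - x" 0] unfolding \<phi>_def by simp
  ultimately have "\<phi> 1 - \<phi> 0 \<ge> grad h x \<bullet> (y - x) * (1 - 0)"
    by (intro convex_on_imp_above_tangent[where A = UNIV]) auto
  then show ?thesis unfolding \<phi>_def by simp
qed

text \<open>
  The bound compares the tangent plane at \<open>x\<close>, which lies below the graph, with the quadratic
  upper bound at \<open>y\<close>, both evaluated at the end point of a gradient step of length \<open>1 / L\<close>.
\<close>

lemma grad_diff_le_Bregman:
  fixes h :: "'a::euclidean_space \<Rightarrow> real"
  assumes conv: "convex_on UNIV h" and L: "L_smooth L h" and "L > 0"
  shows "(norm (grad h y - grad h x))\<^sup>2 \<le> 2 * L * (h y - h x - grad h x \<bullet> (y - x))"
proof -
  define d where "d = grad h y - grad h x"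
  define z where "z = y - (1 / L) *\<^sub>R d"
  have "h x + grad h x \<bullet> (z - x) \<le> h z"
    using L by (intro convex_above_tangent[OF conv]) (auto simp: L_smooth_def)
  also have "\<dots> \<le> h y + grad h y \<bullet> (z - y) + L / 2 * (norm (z - y))\<^sup>2"
    by (rule descent_inequality[OF L])
  finally have "h x + grad h x \<bullet> (y - x) + (grad h y \<bullet> d - grad h x \<bullet> d) / L
      \<le> h y + L / 2 * (norm (z - y))\<^sup>2"
    unfolding z_def by (simp add: algebra_simps inner_diff_right diff_divide_distrib)
  moreover have "grad h y \<bullet> d - grad h x \<bullet> d = (norm d)\<^sup>2"
    unfolding power2_norm_eq_inner by (simp add: d_def inner_diff_left)
  moreover have "L / 2 * (norm (z - y))\<^sup>2 = (norm d)\<^sup>2 / (2 * L)"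
    using \<open>L > 0\<close> by (simp add: z_def power_divide power2_eq_square)
  ultimately have "(norm d)\<^sup>2 / L - (norm d)\<^sup>2 / (2 * L) \<le> h y - h x - grad h x \<bullet> (y - x)"
    by simp
  then show ?thesis using \<open>L > 0\<close> unfolding d_def[symmetric] by (simp add: field_simps)
qed

lemma GDERIV_mean_fun:
  fixes f :: "nat \<Rightarrow> 'a::euclidean_space \<Rightarrow> real"
  assumes "\<And>i. i < n \<Longrightarrow> f i differentiable (at x)"
  shows "GDERIV (mean_fun n f) x :> (1 / real n) *\<^sub>R (\<Sum>i<n. grad (f i) x)"
proof -
  have "((\<lambda>x. (\<Sum>i<n. f i x) / real n) has_derivative
         (\<lambda>v. (\<Sum>i<n. v \<bullet> grad (f i) x) / real n)) (at x)"
    using GDERIV_grad[OF assms] unfolding gderiv_def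
    by (cases "n = 0") (auto intro!: derivative_eq_intros)
  then show ?thesis
    unfolding gderiv_def mean_fun_def
    by (rule has_derivative_eq_rhs) (simp add: inner_sum_right divide_inverse fun_eq_iff)
qed

lemma norm_sum_power2_le:
  fixes v :: "'i \<Rightarrow> 'a::real_inner"
  assumes "finite I"
  shows "(norm (\<Sum>i\<in>I. v i))\<^sup>2 \<le> real (card I) * (\<Sum>i\<in>I. (norm (v i))\<^sup>2)"
proof -
  have "(norm (\<Sum>i\<in>I. v i))\<^sup>2 \<le> (\<Sum>i\<in>I. norm (v i))\<^sup>2"
    by (intro power_mono norm_sum) simp
  also have "\<dots> \<le> real (card I) * (\<Sum>i\<in>I. (norm (v i))\<^sup>2)"
    using sum_squared_le_sum_of_squares[of "\<lambda>i. norm (v i)" I] assms by (simp add: mult.commute)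
  finally show ?thesis .
qed

section \<open>The averaged objective\<close>

locale convex_smooth_mean =
  fixes f :: "nat \<Rightarrow> 'a::euclidean_space \<Rightarrow> real" and n :: nat and L \<mu> :: real and xs :: 'a
  assumes n_pos: "n \<ge> 1" and L_pos: "L > 0"
    and conv: "\<And>i. i < n \<Longrightarrow> convex_on UNIV (f i)"
    and smooth: "\<And>i. i < n \<Longrightarrow> L_smooth L (f i)"
    and qsc: "quasi_strongly_convex \<mu> (mean_fun n f) xs"
begin

abbreviation "h \<equiv> mean_fun n f"

lemma differentiable_f: "i < n \<Longrightarrow> f i differentiable (at x)"
  using smooth unfolding L_smooth_def by blast

lemma GDERIV_h: "GDERIV h x :> (1 / real n) *\<^sub>R (\<Sum>i<n. grad (f i) x)"
  by (rule GDERIV_mean_fun) (rule differentiable_f)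

lemma grad_h: "grad h x = (1 / real n) *\<^sub>R (\<Sum>i<n. grad (f i) x)"
  by (rule grad_eqI) (rule GDERIV_h)

lemma differentiable_h: "h differentiable (at x)"
  using GDERIV_h unfolding gderiv_def differentiable_def by blast

lemma minimum: "h xs \<le> h y"
  using qsc unfolding quasi_strongly_convex_def by blast

lemma grad_h_minimum: "grad h xs = 0"
  by (rule grad_eq_0_at_minimum) (auto intro: differentiable_h minimum)

lemma grad_h_diff: "grad h x = (1 / real n) *\<^sub>R (\<Sum>i<n. grad (f i) x - grad (f i) xs)"
  using grad_h_minimum grad_h[of x] grad_h[of xs]
  by (simp add: sum_subtractf scaleR_diff_right)

lemma sums_h: "(\<Sum>i<n. f i x) = real n * h x"
  using n_pos unfolding mean_fun_def by simp

lemma sum_grad_diff_le: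
  "(\<Sum>i<n. (norm (grad (f i) x - grad (f i) xs))\<^sup>2) \<le> real n * (2 * L * (h x - h xs))"
proof -
  have "(\<Sum>i<n. (norm (grad (f i) x - grad (f i) xs))\<^sup>2)
      \<le> (\<Sum>i<n. 2 * L * (f i x - f i xs - grad (f i) xs \<bullet> (x - xs)))"
    using conv smooth L_pos by (intro sum_mono grad_diff_le_Bregman) auto
  also have "\<dots> = 2 * L * ((\<Sum>i<n. f i x) - (\<Sum>i<n. f i xs) - (\<Sum>i<n. grad (f i) xs) \<bullet> (x - xs))"
    by (simp add: sum_distrib_left[symmetric] sum_subtractf inner_sum_left)
  also have "(\<Sum>i<n. grad (f i) xs) = 0"
    using grad_h_minimum n_pos unfolding grad_h by simp
  finally show ?thesis
    using n_pos by (simp add: sums_h right_diff_distrib mult.commute mult.left_commute)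
qed

lemma grad_h_le: "(norm (grad h x))\<^sup>2 \<le> 2 * L * (h x - h xs)"
proof -
  have "(norm (grad h x))\<^sup>2 = (1 / real n)\<^sup>2 * (norm (\<Sum>i<n. grad (f i) x - grad (f i) xs))\<^sup>2"
    unfolding grad_h_diff by (simp add: power_divide)
  also have "\<dots> \<le> (1 / real n)\<^sup>2 * (real n * (\<Sum>i<n. (norm (grad (f i) x - grad (f i) xs))\<^sup>2))"
    using norm_sum_power2_le[of "{..<n}" "\<lambda>i. grad (f i) x - grad (f i) xs"]
    by (intro mult_left_mono) auto
  also have "\<dots> \<le> (1 / real n)\<^sup>2 * (real n * (real n * (2 * L * (h x - h xs))))"
    by (intro mult_left_mono sum_grad_diff_le) auto
  also have "\<dots> = 2 * L * (h x - h xs)"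
    using n_pos by (simp add: power2_eq_square field_simps)
  finally show ?thesis .
qed

lemma grad_h_Lipschitz_minimum: "norm (grad h x) \<le> L * norm (x - xs)"
proof -
  have "norm (grad h x) = (1 / real n) * norm (\<Sum>i<n. grad (f i) x - grad (f i) xs)"
    unfolding grad_h_diff by simp
  also have "\<dots> \<le> (1 / real n) * (\<Sum>i<n. L * norm (x - xs))"
    using smooth by (intro mult_left_mono sum_norm_le L_smooth_grad_le) auto
  also have "\<dots> = L * norm (x - xs)"
    using n_pos by simp
  finally show ?thesis .
qed

lemma qsc_inner: "h x - h xs + \<mu> / 2 * (norm (x - xs))\<^sup>2 \<le> grad h x \<bullet> (x - xs)"
proof -
  have "h xs \<ge> h x + grad h x \<bullet> (xs - x) + \<mu> / 2 * (norm (x - xs))\<^sup>2"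
    using qsc unfolding quasi_strongly_convex_def by blast
  then show ?thesis by (simp add: inner_diff_right)
qed

lemma gap_le: "h x - h xs + \<mu> / 2 * (norm (x - xs))\<^sup>2 \<le> L * (norm (x - xs))\<^sup>2"
proof -
  have "grad h x \<bullet> (x - xs) \<le> norm (grad h x) * norm (x - xs)"
    by (rule norm_cauchy_schwarz)
  also have "\<dots> \<le> L * norm (x - xs) * norm (x - xs)"
    by (intro mult_right_mono grad_h_Lipschitz_minimum) simp
  finally show ?thesis using qsc_inner[of x] by (simp add: power2_eq_square)
qed

text \<open>
  Away from the minimizer, quasi strong convexity and the gradient bound \<open>grad_h_le\<close> together
  give \<open>G\<^sup>2 / (2 * L) + \<mu> / 2 * d\<^sup>2 \<le> G * d\<close> for the gradient norm \<open>G\<close> and the distance \<open>d\<close>,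
  while \<open>G * d \<le> G\<^sup>2 / (2 * L) + L / 2 * d\<^sup>2\<close> always.
\<close>

lemma mu_le_L: "\<mu> \<le> L"
proof -
  obtain b :: 'a where "b \<in> Basis"
    using nonempty_Basis by blast
  define x where "x = xs + b"
  have d: "norm (x - xs) = 1"
    using \<open>b \<in> Basis\<close> by (simp add: x_def)
  define G where "G = norm (grad h x)"
  have "G\<^sup>2 / (2 * L) \<le> h x - h xs"
    using grad_h_le[of x] L_pos unfolding G_def by (simp add: field_simps)
  moreover have "h x - h xs + \<mu> / 2 \<le> G"
    using qsc_inner[of x] norm_cauchy_schwarz[of "grad h x" "x - xs"] d unfolding G_def by simp
  ultimately have "G\<^sup>2 / (2 * L) + \<mu> / 2 \<le> G"
    by simp
  then have "G\<^sup>2 + \<mu> * L \<le> 2 * L * G"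
    using L_pos by (simp add: field_simps)
  moreover have "0 \<le> (G - L)\<^sup>2" by simp
  ultimately have "\<mu> * L \<le> L * L"
    by (simp add: power2_eq_square algebra_simps)
  then show ?thesis using L_pos by simp
qed

lemma grad_f_continuous: "i < n \<Longrightarrow> continuous_on UNIV (grad (f i))"
  using smooth lipschitz_on_continuous_on unfolding L_smooth_def by blast

lemma grad_f_measurable [measurable]: "i < n \<Longrightarrow> grad (f i) \<in> borel_measurable borel"
  by (intro borel_measurable_continuous_onI grad_f_continuous)

lemma grad_h_measurable [measurable]: "grad h \<in> borel_measurable borel"
proof -
  have "(\<lambda>x. (1 / real n) *\<^sub>R (\<Sum>i<n. grad (f i) x)) \<in> borel_measurable borel"
    by measurable
  then show ?thesis by (simp add: grad_h[abs_def])
qed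

lemma h_measurable [measurable]: "h \<in> borel_measurable borel"
  by (intro borel_measurable_continuous_onI differentiable_imp_continuous_on)
     (auto simp: differentiable_on_def intro: differentiable_at_withinI differentiable_h)

lemma convex_h: "convex_on UNIV h"
proof (rule convex_onI)
  fix t :: real and a b :: 'a assume "0 < t" "t < 1"
  have "(\<Sum>i<n. f i ((1 - t) *\<^sub>R a + t *\<^sub>R b)) \<le> (\<Sum>i<n. (1 - t) * f i a + t * f i b)"
    using conv \<open>0 < t\<close> \<open>t < 1\<close> by (intro sum_mono convex_onD) auto
  then have "real n * h ((1 - t) *\<^sub>R a + t *\<^sub>R b) \<le> real n * ((1 - t) * h a + t * h b)"
    by (simp only: sums_h sum.distrib sum_distrib_left[symmetric])
       (simp add: distrib_left mult.left_commute)
  then show "h ((1 - t) *\<^sub>R a + t *\<^sub>R b) \<le> (1 - t) * h a + t * h b"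
    using n_pos by simp
qed simp

end

section \<open>Square-integrable random vectors\<close>

definition square_integrable :: "'w measure \<Rightarrow> ('w \<Rightarrow> 'a::euclidean_space) \<Rightarrow> bool" where
  "square_integrable M X \<longleftrightarrow> X \<in> borel_measurable M \<and> integrable M (\<lambda>w. (norm (X w))\<^sup>2)"

lemma square_integrable_measurable [measurable_dest]:
  "square_integrable M X \<Longrightarrow> X \<in> borel_measurable M"
  unfolding square_integrable_def by simp

lemma square_integrable_norm:
  "square_integrable M X \<Longrightarrow> integrable M (\<lambda>w. (norm (X w))\<^sup>2)"
  unfolding square_integrable_def by simp

lemma square_integrable_bound:
  assumes "square_integrable M X" and [measurable]: "Y \<in> borel_measurable M"
    and "\<And>w. norm (Y w) \<le> c * norm (X w)"
  shows "square_integrable M Y"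
  unfolding square_integrable_def
proof
  show "integrable M (\<lambda>w. (norm (Y w))\<^sup>2)"
  proof (rule Bochner_Integration.integrable_bound)
    show "integrable M (\<lambda>w. c\<^sup>2 * (norm (X w))\<^sup>2)"
      using square_integrable_norm[OF assms(1)] by simp
    show "AE w in M. norm ((norm (Y w))\<^sup>2) \<le> norm (c\<^sup>2 * (norm (X w))\<^sup>2)"
      using power_mono[OF assms(3) norm_ge_zero, of _ 2] by (simp add: power_mult_distrib)
  qed measurable
qed measurable

lemma square_integrable_add:
  assumes X: "square_integrable M X" and Y: "square_integrable M Y"
  shows "square_integrable M (\<lambda>w. X w + Y w)"
  unfolding square_integrable_def
proof
  have [measurable]: "X \<in> borel_measurable M" "Y \<in> borel_measurable M"
    using X Y by (auto dest: square_integrable_measurable)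
  show "(\<lambda>w. X w + Y w) \<in> borel_measurable M" by measurable
  show "integrable M (\<lambda>w. (norm (X w + Y w))\<^sup>2)"
  proof (rule Bochner_Integration.integrable_bound)
    show "integrable M (\<lambda>w. 2 * (norm (X w))\<^sup>2 + 2 * (norm (Y w))\<^sup>2)"
      using square_integrable_norm[OF X] square_integrable_norm[OF Y] by simp
    have "(norm (X w + Y w))\<^sup>2 \<le> 2 * (norm (X w))\<^sup>2 + 2 * (norm (Y w))\<^sup>2" for w
      using zero_le_power2[of "norm (X w - Y w)"]
      by (simp add: power2_norm_eq_inner inner_add_left inner_add_right inner_diff_left
          inner_diff_right inner_commute)
    then show "AE w in M. norm ((norm (X w + Y w))\<^sup>2) \<le> norm (2 * (norm (X w))\<^sup>2 + 2 * (norm (Y w))\<^sup>2)"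
      by simp
  qed measurable
qed

lemma square_integrable_scaleR:
  assumes X: "square_integrable M X"
  shows "square_integrable M (\<lambda>w. c *\<^sub>R X w)"
proof (rule square_integrable_bound[OF X, of _ "\<bar>c\<bar>"])
  show "(\<lambda>w. c *\<^sub>R X w) \<in> borel_measurable M"
    using X by (auto dest: square_integrable_measurable)
qed simp

lemma square_integrable_diff:
  assumes "square_integrable M X" "square_integrable M Y"
  shows "square_integrable M (\<lambda>w. X w - Y w)"
  using square_integrable_add[OF assms(1) square_integrable_scaleR[OF assms(2), of "-1"]] by simp

lemma square_integrable_sum:
  assumes "\<And>i. i \<in> I \<Longrightarrow> square_integrable M (X i)"
  shows "square_integrable M (\<lambda>w. \<Sum>i\<in>I. X i w)"
  using assms
proof (induction I rule: infinite_finite_induct)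
  case (insert i I)
  then show ?case by (simp add: square_integrable_add)
qed (simp_all add: square_integrable_def)

lemma square_integrable_indicator:
  assumes X: "square_integrable M X" and A: "A \<in> sets M"
  shows "square_integrable M (\<lambda>w. indicator A w *\<^sub>R X w)"
proof (rule square_integrable_bound[OF X])
  have [measurable]: "X \<in> borel_measurable M"
    using X by (rule square_integrable_measurable)
  show "(\<lambda>w. indicator A w *\<^sub>R X w) \<in> borel_measurable M"
    using A by measurable
  show "norm (indicator A w *\<^sub>R X w) \<le> 1 * norm (X w)" for w
    by (auto split: split_indicator)
qed

lemma integrable_inner:
  assumes X: "square_integrable M X" and Y: "square_integrable M Y"
  shows "integrable M (\<lambda>w. X w \<bullet> Y w)"
proof (rule Bochner_Integration.integrable_bound)
  have [measurable]: "X \<in> borel_measurable M" "Y \<in> borel_measurable M"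
    using X Y by (auto dest: square_integrable_measurable)
  show "integrable M (\<lambda>w. (norm (X w))\<^sup>2 + (norm (Y w))\<^sup>2)"
    using square_integrable_norm[OF X] square_integrable_norm[OF Y] by simp
  have "\<bar>X w \<bullet> Y w\<bar> \<le> (norm (X w))\<^sup>2 + (norm (Y w))\<^sup>2" for w
  proof -
    have "\<bar>X w \<bullet> Y w\<bar> \<le> norm (X w) * norm (Y w)"
      by (rule Cauchy_Schwarz_ineq2)
    also have "2 * (norm (X w) * norm (Y w)) \<le> (norm (X w))\<^sup>2 + (norm (Y w))\<^sup>2"
      using sum_squares_bound[of "norm (X w)" "norm (Y w)"] by simp
    finally show ?thesis using mult_nonneg_nonneg[of "norm (X w)" "norm (Y w)"] by linarith
  qed
  then show "AE w in M. norm (X w \<bullet> Y w) \<le> norm ((norm (X w))\<^sup>2 + (norm (Y w))\<^sup>2)"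
    by simp
  show "(\<lambda>w. X w \<bullet> Y w) \<in> borel_measurable M"
    by measurable
qed

lemma (in finite_measure) square_integrable_const: "square_integrable M (\<lambda>w. c)"
  unfolding square_integrable_def by simp

lemma (in finite_measure) square_integrable_integrable:
  assumes X: "square_integrable M X"
  shows "integrable M X"
proof (rule Bochner_Integration.integrable_bound)
  have [measurable]: "X \<in> borel_measurable M"
    using X by (rule square_integrable_measurable)
  show "integrable M (\<lambda>w. 1 + (norm (X w))\<^sup>2)"
    using square_integrable_norm[OF X] by simp
  have "norm (X w) \<le> 1 + (norm (X w))\<^sup>2" for w
    using sum_squares_bound[of 1 "norm (X w)"] norm_ge_zero[of "X w"]
    unfolding power_one mult_1_right by linarith
  then show "AE w in M. norm (X w) \<le> norm (1 + (norm (X w))\<^sup>2)"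
    by simp
qed (use X in \<open>rule square_integrable_measurable\<close>)

lemma integral_norm_add_power2:
  assumes X: "square_integrable M X" and Y: "square_integrable M Y"
  shows "(LINT w|M. (norm (X w + Y w))\<^sup>2)
       = (LINT w|M. (norm (X w))\<^sup>2) + 2 * (LINT w|M. X w \<bullet> Y w) + (LINT w|M. (norm (Y w))\<^sup>2)"
proof -
  have "(\<lambda>w. (norm (X w + Y w))\<^sup>2) = (\<lambda>w. (norm (X w))\<^sup>2 + 2 * (X w \<bullet> Y w) + (norm (Y w))\<^sup>2)"
    by (simp add: power2_norm_eq_inner inner_add_left inner_add_right inner_commute fun_eq_iff)
  then show ?thesis
    using square_integrable_norm[OF X] square_integrable_norm[OF Y] integrable_inner[OF X Y] by simp
qed

lemma integral_norm_sum_orthogonal: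
  assumes "finite I" and "\<And>i. i \<in> I \<Longrightarrow> square_integrable M (X i)"
    and "\<And>i j. i \<in> I \<Longrightarrow> j \<in> I \<Longrightarrow> i \<noteq> j \<Longrightarrow> (LINT w|M. X i w \<bullet> X j w) = 0"
  shows "(LINT w|M. (norm (\<Sum>i\<in>I. X i w))\<^sup>2) = (\<Sum>i\<in>I. LINT w|M. (norm (X i w))\<^sup>2)"
  using assms
proof (induction I rule: finite_induct)
  case (insert i I)
  have "(LINT w|M. (norm (\<Sum>j\<in>insert i I. X j w))\<^sup>2) = (LINT w|M. (norm (X i w + (\<Sum>j\<in>I. X j w)))\<^sup>2)"
    using insert.hyps by simp
  also have "\<dots> = (LINT w|M. (norm (X i w))\<^sup>2) + 2 * (LINT w|M. X i w \<bullet> (\<Sum>j\<in>I. X j w))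
      + (LINT w|M. (norm (\<Sum>j\<in>I. X j w))\<^sup>2)"
    using insert.prems by (intro integral_norm_add_power2 square_integrable_sum) auto
  also have "(LINT w|M. X i w \<bullet> (\<Sum>j\<in>I. X j w)) = (\<Sum>j\<in>I. LINT w|M. X i w \<bullet> X j w)"
    unfolding inner_sum_right using insert.prems
    by (intro Bochner_Integration.integral_sum integrable_inner) auto
  also have "\<dots> = 0"
    using insert by (intro sum.neutral) auto
  finally show ?case
    using insert by simp
qed simp

lemma set_integral_norm_add_orthogonal:
  fixes X Y :: "'w \<Rightarrow> 'a::euclidean_space"
  assumes X: "square_integrable M X" and Y: "square_integrable M Y" and A: "A \<in> sets M"
    and orth: "(LINT w:A|M. X w \<bullet> Y w) = 0"
  shows "(LINT w:A|M. (norm (X w + Y w))\<^sup>2) = (LINT w:A|M. (norm (X w))\<^sup>2) + (LINT w:A|M. (norm (Y w))\<^sup>2)"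
proof -
  have ind: "(norm (indicat_real A w *\<^sub>R v))\<^sup>2 = indicat_real A w *\<^sub>R (norm v)\<^sup>2"
    "(indicat_real A w *\<^sub>R u) \<bullet> (indicat_real A w *\<^sub>R v) = indicat_real A w *\<^sub>R (u \<bullet> v)" for w and u v :: 'a
    by (auto split: split_indicator)
  show ?thesis
    using integral_norm_add_power2[OF square_integrable_indicator[OF X A] square_integrable_indicator[OF Y A]] orth
    unfolding scaleR_add_right[symmetric] ind set_lebesgue_integral_def by simp
qed

lemma set_integral_norm_sum_orthogonal:
  fixes X :: "'i \<Rightarrow> 'w \<Rightarrow> 'a::euclidean_space"
  assumes "finite I" and X: "\<And>i. i \<in> I \<Longrightarrow> square_integrable M (X i)" and A: "A \<in> sets M"
    and orth: "\<And>i j. i \<in> I \<Longrightarrow> j \<in> I \<Longrightarrow> i \<noteq> j \<Longrightarrow> (LINT w:A|M. X i w \<bullet> X j w) = 0"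
  shows "(LINT w:A|M. (norm (\<Sum>i\<in>I. X i w))\<^sup>2) = (\<Sum>i\<in>I. LINT w:A|M. (norm (X i w))\<^sup>2)"
proof -
  have ind: "(norm (indicat_real A w *\<^sub>R v))\<^sup>2 = indicat_real A w *\<^sub>R (norm v)\<^sup>2"
    "(indicat_real A w *\<^sub>R u) \<bullet> (indicat_real A w *\<^sub>R v) = indicat_real A w *\<^sub>R (u \<bullet> v)" for w and u v :: 'a
    by (auto split: split_indicator)
  have "(LINT w|M. (norm (\<Sum>i\<in>I. indicat_real A w *\<^sub>R X i w))\<^sup>2)
      = (\<Sum>i\<in>I. LINT w|M. (norm (indicat_real A w *\<^sub>R X i w))\<^sup>2)"
  proof (rule integral_norm_sum_orthogonal[OF \<open>finite I\<close> square_integrable_indicator[OF X A]])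
    show "(LINT w|M. (indicat_real A w *\<^sub>R X i w) \<bullet> (indicat_real A w *\<^sub>R X j w)) = 0"
      if "i \<in> I" "j \<in> I" "i \<noteq> j" for i j
      unfolding ind using orth[OF that] unfolding set_lebesgue_integral_def .
  qed
  then show ?thesis
    unfolding scaleR_sum_right[symmetric] ind set_lebesgue_integral_def .
qed

section \<open>Vectors with vanishing conditional expectation\<close>

definition centered :: "'w measure \<Rightarrow> 'w measure \<Rightarrow> ('w \<Rightarrow> 'a::euclidean_space) \<Rightarrow> bool" where
  "centered M G X \<longleftrightarrow> integrable M X \<and> (\<forall>A\<in>sets G. (LINT w:A|M. X w) = 0)"

lemma centered_mono: "centered M G X \<Longrightarrow> sets F \<subseteq> sets G \<Longrightarrow> centered M F X"
  unfolding centered_def by blast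

lemma has_cond_exp_centered_diff:
  assumes "has_cond_exp M F X Y" and "subalgebra M F"
  shows "centered M F (\<lambda>w. X w - Y w)"
proof -
  have "set_integrable M A X" "set_integrable M A Y" if "A \<in> sets F" for A
    using assms that integrable_mult_indicator unfolding has_cond_exp_def set_integrable_def subalgebra_def
    by blast+
  then show ?thesis
    using assms unfolding has_cond_exp_def centered_def by (auto simp: set_integral_diff)
qed

lemma (in prob_space) sigma_finite_subalgebraI:
  assumes "subalgebra M G" shows "sigma_finite_subalgebra M G"
proof -
  interpret finite_measure_subalgebra M G
    by unfold_locales (use assms in auto)
  show ?thesis by unfold_locales
qed

lemma (in prob_space) centered_mult_integral_eq_0:
  fixes X Z :: "'a \<Rightarrow> real"
  assumes X: "centered M G X" and G: "subalgebra M G"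
    and Z: "Z \<in> borel_measurable G" and int: "integrable M (\<lambda>w. Z w * X w)"
  shows "(LINT w|M. Z w * X w) = 0"
proof -
  interpret sigma_finite_subalgebra M G
    by (rule sigma_finite_subalgebraI[OF G])
  have intX: "integrable M X"
    using X unfolding centered_def by simp
  have "AE w in M. real_cond_exp M G X w = 0"
    using X unfolding centered_def by (intro real_cond_exp_charact) auto
  then have "(LINT w|M. Z w * real_cond_exp M G X w) = (LINT w|M. 0)"
    using measurable_from_subalg[OF G Z] by (intro integral_cong_AE) auto
  then show ?thesis
    using real_cond_exp_intg(2)[OF int Z] intX by simp
qed

lemma set_integral_inner_left:
  fixes X :: "'w \<Rightarrow> 'a::euclidean_space"
  assumes "integrable M X" and "A \<in> sets M"
  shows "(LINT w:A|M. X w \<bullet> b) = (LINT w:A|M. X w) \<bullet> b"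
  using integrable_mult_indicator[OF assms(2,1)]
  unfolding set_lebesgue_integral_def by (subst integral_inner_left[symmetric]) simp_all

lemma centered_iff_components:
  fixes X :: "'w \<Rightarrow> 'a::euclidean_space"
  assumes X: "integrable M X" and G: "subalgebra M G"
  shows "centered M G X \<longleftrightarrow> (\<forall>b\<in>Basis. centered M G (\<lambda>w. X w \<bullet> b))"
proof -
  have "A \<in> sets M" if "A \<in> sets G" for A
    using G that unfolding subalgebra_def by blast
  then have "(LINT w:A|M. X w \<bullet> b) = (LINT w:A|M. X w) \<bullet> b" if "A \<in> sets G" for A b
    using set_integral_inner_left[OF X] that by blast
  then show ?thesis
    using X unfolding centered_def euclidean_all_zero_iff[symmetric, where 'a='a] by auto
qed

lemma (in prob_space) centered_orthogonal:
  fixes X Z :: "'a \<Rightarrow> 'b::euclidean_space"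
  assumes cX: "centered M G X" and G: "subalgebra M G" and X: "square_integrable M X"
    and Z: "Z \<in> borel_measurable G" "square_integrable M Z"
  shows "(LINT w|M. X w \<bullet> Z w) = 0"
proof -
  have comp: "integrable M (\<lambda>w. (Z w \<bullet> b) * (X w \<bullet> b))
      \<and> (LINT w|M. (Z w \<bullet> b) * (X w \<bullet> b)) = 0" if "b \<in> Basis" for b
  proof -
    have sq: "square_integrable M (\<lambda>w. Y w \<bullet> b)" if Y: "square_integrable M Y" for Y :: "'a \<Rightarrow> 'b"
    proof (rule square_integrable_bound[OF Y])
      show "norm (Y w \<bullet> b) \<le> 1 * norm (Y w)" for w
        using Basis_le_norm[OF \<open>b \<in> Basis\<close>] by simp
      show "(\<lambda>w. Y w \<bullet> b) \<in> borel_measurable M"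
        using Y by (auto dest: square_integrable_measurable)
    qed
    have int: "integrable M (\<lambda>w. (Z w \<bullet> b) * (X w \<bullet> b))"
      using integrable_inner[OF sq[OF Z(2)] sq[OF X]] by simp
    moreover have "centered M G (\<lambda>w. X w \<bullet> b)"
      using cX centered_iff_components[of M X G] G that unfolding centered_def by blast
    ultimately show ?thesis
      using Z(1) by (intro conjI centered_mult_integral_eq_0[OF _ G]) auto
  qed
  have "(LINT w|M. X w \<bullet> Z w) = (LINT w|M. (\<Sum>b\<in>Basis. (Z w \<bullet> b) * (X w \<bullet> b)))"
    by (subst euclidean_inner) (simp add: mult.commute)
  also have "\<dots> = (\<Sum>b\<in>Basis. LINT w|M. (Z w \<bullet> b) * (X w \<bullet> b))"
    using comp by (intro Bochner_Integration.integral_sum) auto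
  finally show ?thesis using comp by simp
qed

lemma (in prob_space) set_integral_orthogonal:
  fixes X Z :: "'a \<Rightarrow> 'b::euclidean_space"
  assumes cX: "centered M G X" and G: "subalgebra M G" and X: "square_integrable M X"
    and Z: "Z \<in> borel_measurable G" "square_integrable M Z" and A: "A \<in> sets G"
  shows "(LINT w:A|M. X w \<bullet> Z w) = 0"
proof -
  have AM: "A \<in> sets M"
    using A G unfolding subalgebra_def by blast
  have "(\<lambda>w. indicat_real A w *\<^sub>R Z w) \<in> borel_measurable G"
    using A Z(1) by (intro borel_measurable_scaleR borel_measurable_indicator)
  then have "(LINT w|M. X w \<bullet> (indicator A w *\<^sub>R Z w)) = 0"
    using square_integrable_indicator[OF Z(2) AM] by (intro centered_orthogonal[OF cX G X])
  then show ?thesis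
    unfolding set_lebesgue_integral_def by simp
qed

lemma centered_add:
  assumes X: "centered M G X" and Y: "centered M G Y" and G: "subalgebra M G"
  shows "centered M G (\<lambda>w. X w + Y w)"
proof -
  have "set_integrable M A X" "set_integrable M A Y" if "A \<in> sets G" for A
    using assms that integrable_mult_indicator unfolding centered_def set_integrable_def subalgebra_def
    by blast+
  then show ?thesis
    using X Y unfolding centered_def by (auto simp: set_integral_add)
qed

lemma centered_scaleR: "centered M G X \<Longrightarrow> centered M G (\<lambda>w. c *\<^sub>R X w)"
  unfolding centered_def by simp

lemma centered_sum:
  assumes "\<And>i. i \<in> I \<Longrightarrow> centered M G (X i)" and G: "subalgebra M G"
  shows "centered M G (\<lambda>w. \<Sum>i\<in>I. X i w)"
  using assms(1)
proof (induction I rule: infinite_finite_induct)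
  case (insert i I)
  then show ?case by (simp add: centered_add[OF _ _ G])
qed (simp_all add: centered_def set_lebesgue_integral_def)

lemma set_integral_eq_0_sigma_sets:
  fixes X :: "'w \<Rightarrow> 'a::euclidean_space"
  assumes X: "integrable M X" and stable: "Int_stable P" and P: "P \<subseteq> sets M" "space M \<in> P"
    and zero: "\<And>A. A \<in> P \<Longrightarrow> (LINT w:A|M. X w) = 0"
    and A: "A \<in> sigma_sets (space M) P"
  shows "(LINT w:A|M. X w) = 0"
proof -
  have P': "P \<subseteq> Pow (space M)"
    using P(1) sets.space_closed by blast
  have sub: "sigma_sets (space M) P \<subseteq> sets M"
    using P(1) by (rule sets.sigma_sets_subset)
  have intA: "set_integrable M B X" if "B \<in> sigma_sets (space M) P" for B
    using X sub that integrable_mult_indicator unfolding set_integrable_def by blast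
  have total: "(LINT w|M. X w) = 0"
    using zero[OF P(2)] X by (simp add: set_integral_space)
  show ?thesis
    using stable P' A
  proof (induction rule: sigma_sets_induct_disjoint)
    case (basic A)
    then show ?case by (rule zero)
  next
    case empty
    show ?case by (simp add: set_lebesgue_integral_def)
  next
    case (compl A)
    have "(LINT w:(space M - A) \<union> A|M. X w) = (LINT w:space M - A|M. X w) + (LINT w:A|M. X w)"
      using compl.hyps intA sigma_sets.Compl[of A] by (intro set_integral_Un) auto
    moreover have "(space M - A) \<union> A = space M"
      using compl.hyps sub sets.sets_into_space by blast
    ultimately show ?case
      using compl.IH total X by (simp add: set_integral_space)
  next
    case (union A)
    have "(LINT w:(\<Union>i. A i)|M. X w) = (\<Sum>i. LINT w:A i|M. X w)"
    proof (rule lebesgue_integral_countable_add)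
      show "set_integrable M (\<Union>i. A i) X"
        using union.hyps by (intro intA sigma_sets.Union) auto
    qed (use union.hyps sub in \<open>auto simp: disjoint_family_on_def dest!: range_subsetD\<close>)
    then show ?case using union.IH by simp
  qed
qed

abbreviation join :: "'w measure \<Rightarrow> 'w measure \<Rightarrow> 'w measure \<Rightarrow> 'w measure" where
  "join M F G \<equiv> sigma (space M) (sets F \<union> sets G)"

lemma subalgebra_sigma:
  assumes "P \<subseteq> sets M"
  shows "subalgebra M (sigma (space M) P)"
proof -
  have "P \<subseteq> Pow (space M)"
    using assms sets.space_closed by blast
  then show ?thesis
    using sets.sigma_sets_subset[OF assms] unfolding subalgebra_def by (simp add: space_measure_of_conv)
qed

lemma subalgebra_join: "subalgebra M F \<Longrightarrow> subalgebra M G \<Longrightarrow> subalgebra M (join M F G)"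
  by (rule subalgebra_sigma) (auto simp: subalgebra_def)

lemma sets_sigma_mono:
  assumes "P \<subseteq> sets N" and "space N = \<Omega>"
  shows "sets (sigma \<Omega> P) \<subseteq> sets N"
proof -
  have "P \<subseteq> Pow \<Omega>"
    using assms sets.space_closed by blast
  then show ?thesis
    using sets.sigma_sets_subset[OF assms(1)] assms(2) by simp
qed

lemma sets_sigma_superset: "P \<subseteq> Pow \<Omega> \<Longrightarrow> P \<subseteq> sets (sigma \<Omega> P)"
  by auto

lemma sets_join_superset:
  assumes "subalgebra M F" "subalgebra M G"
  shows "sets F \<subseteq> sets (join M F G)" "sets G \<subseteq> sets (join M F G)"
proof -
  have "sets F \<union> sets G \<subseteq> Pow (space M)"
    using assms sets.space_closed[of F] sets.space_closed[of G] unfolding subalgebra_def by simp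
  then show "sets F \<subseteq> sets (join M F G)" "sets G \<subseteq> sets (join M F G)"
    using sets_sigma_superset by blast+
qed

text \<open>
  The intersections of an event of \<open>F\<close> with an event of \<open>G\<close> form a generator of the join that is closed
  under intersection, so it suffices to test on them.
\<close>

lemma centered_joinI:
  fixes X :: "'w \<Rightarrow> 'a::euclidean_space"
  assumes X: "integrable M X" and F: "subalgebra M F" and G: "subalgebra M G"
    and zero: "\<And>A B. A \<in> sets F \<Longrightarrow> B \<in> sets G \<Longrightarrow> (LINT w:A \<inter> B|M. X w) = 0"
  shows "centered M (join M F G) X"
  unfolding centered_def
proof (intro conjI ballI X)
  define P where "P = {A \<inter> B |A B. A \<in> sets F \<and> B \<in> sets G}"
  have sp: "space F = space M" "space G = space M" and sub: "sets F \<subseteq> sets M" "sets G \<subseteq> sets M"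
    using F G unfolding subalgebra_def by auto
  have stable: "Int_stable P"
  proof (rule Int_stableI)
    fix C D assume "C \<in> P" "D \<in> P"
    then obtain A B A' B' where "C = A \<inter> B" "D = A' \<inter> B'"
      and "A \<in> sets F" "A' \<in> sets F" "B \<in> sets G" "B' \<in> sets G"
      unfolding P_def by blast
    then have "C \<inter> D = (A \<inter> A') \<inter> (B \<inter> B')" "A \<inter> A' \<in> sets F" "B \<inter> B' \<in> sets G"
      by auto
    then show "C \<inter> D \<in> P"
      unfolding P_def by blast
  qed
  have PM: "P \<subseteq> sets M" "space M \<in> P"
  proof -
    show "P \<subseteq> sets M"
      using sub unfolding P_def by blast
    have "space M = space M \<inter> space M" "space M \<in> sets F" "space M \<in> sets G"
      using sets.top[of F] sets.top[of G] sp by auto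
    then show "space M \<in> P"
      unfolding P_def by blast
  qed
  have FP: "sets F \<union> sets G \<subseteq> P"
  proof
    fix A assume "A \<in> sets F \<union> sets G"
    then have "A = A \<inter> space M" "A = space M \<inter> A"
      using sub sets.sets_into_space by blast+
    then show "A \<in> P"
      using \<open>A \<in> sets F \<union> sets G\<close> sets.top[of F] sets.top[of G] sp unfolding P_def by auto
  qed
  fix C assume C: "C \<in> sets (join M F G)"
  have "sets F \<union> sets G \<subseteq> Pow (space M)"
    using sub sets.space_closed by blast
  then have "C \<in> sigma_sets (space M) (sets F \<union> sets G)"
    using C by simp
  then have "C \<in> sigma_sets (space M) P"
    using sigma_sets_mono'[OF FP] by blast
  then show "(LINT w:C|M. X w) = 0"
    by (rule set_integral_eq_0_sigma_sets[OF X stable PM, rotated]) (auto simp: P_def zero)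
qed

section \<open>Bounds on conditional expectations\<close>

text \<open>The event on which the conditional expectation exceeds the bound is itself a test event.\<close>

lemma (in prob_space) cond_exp_leI:
  assumes F: "subalgebra M F" and X: "integrable M X" and Y: "integrable M Y" "Y \<in> borel_measurable F"
    and le: "\<And>A. A \<in> sets F \<Longrightarrow> (LINT w:A|M. X w) \<le> (LINT w:A|M. Y w)"
  shows "cond_exp_le M F X Y"
  unfolding cond_exp_le_def
proof
  interpret sigma_finite_subalgebra M F
    by (rule sigma_finite_subalgebraI[OF F])
  define U where "U = real_cond_exp M F X"
  have U: "integrable M U" "U \<in> borel_measurable F"
    unfolding U_def using X by auto
  define A where "A = {w \<in> space M. Y w < U w}"
  have "{w \<in> space F. Y w < U w} \<in> sets F"
    using U(2) Y(2) by measurable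
  then have A: "A \<in> sets F"
    using F unfolding A_def subalgebra_def by simp
  then have AM: "A \<in> sets M"
    using F unfolding subalgebra_def by blast
  have intA: "set_integrable M A V" if "integrable M V" for V :: "'a \<Rightarrow> real"
    using that AM integrable_mult_indicator unfolding set_integrable_def by blast
  have "(LINT w:A|M. U w - Y w) = (LINT w:A|M. X w) - (LINT w:A|M. Y w)"
    using real_cond_exp_intA[OF X A] intA U(1) Y(1) unfolding U_def by (simp add: set_integral_diff)
  then have "(LINT w:A|M. U w - Y w) \<le> 0"
    using le[OF A] by simp
  moreover have pos: "0 \<le> indicator A w *\<^sub>R (U w - Y w)" for w
    by (auto simp: A_def split: split_indicator)
  ultimately have "(LINT w|M. indicator A w *\<^sub>R (U w - Y w)) = 0"
    unfolding set_lebesgue_integral_def by (intro antisym Bochner_Integration.integral_nonneg) auto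
  then have "AE w in M. indicator A w *\<^sub>R (U w - Y w) = 0"
    using pos intA[OF Bochner_Integration.integrable_diff[OF U(1) Y(1)]]
    by (subst (asm) integral_nonneg_eq_0_iff_AE) (auto simp: set_integrable_def)
  then show "AE w in M. real_cond_exp M F X w \<le> Y w"
    by (rule AE_mp) (auto simp: A_def U_def not_less split: split_indicator_asm intro!: AE_I2)
qed (rule X)

lemma (in prob_space) cond_exp_leD:
  assumes F: "subalgebra M F" and le: "cond_exp_le M F X Y" and Y: "integrable M Y" and A: "A \<in> sets F"
  shows "(LINT w:A|M. X w) \<le> (LINT w:A|M. Y w)"
proof -
  interpret sigma_finite_subalgebra M F
    by (rule sigma_finite_subalgebraI[OF F])
  have AM: "A \<in> sets M"
    using F A unfolding subalgebra_def by blast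
  have X: "integrable M X" and AE: "AE w in M. real_cond_exp M F X w \<le> Y w"
    using le unfolding cond_exp_le_def by auto
  have "(LINT w:A|M. X w) = (LINT w:A|M. real_cond_exp M F X w)"
    by (rule real_cond_exp_intA[OF X A])
  also have "\<dots> \<le> (LINT w:A|M. Y w)"
    unfolding set_lebesgue_integral_def
  proof (rule integral_mono_AE)
    show "integrable M (\<lambda>w. indicat_real A w *\<^sub>R real_cond_exp M F X w)"
      using real_cond_exp_int(1)[OF X] AM integrable_mult_indicator by blast
    show "integrable M (\<lambda>w. indicat_real A w *\<^sub>R Y w)"
      using Y AM integrable_mult_indicator by blast
    show "AE w in M. indicat_real A w *\<^sub>R real_cond_exp M F X w \<le> indicat_real A w *\<^sub>R Y w"
      using AE by (rule AE_mp) (auto split: split_indicator intro!: AE_I2)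
  qed
  finally show ?thesis .
qed

section \<open>Conditional independence\<close>

text \<open>
  If two random elements are conditionally independent given \<open>F\<close>, then revealing the first one on
  top of \<open>F\<close> does not change the conditional mean of a function of the second one. For an event
  \<open>B\<close> of the first element with conditional probability \<open>p\<close>, conditional independence says that
  \<open>indicator B - p\<close>, restricted to an event of \<open>F\<close>, integrates to zero over the events generated
  by \<open>F\<close> and the second element. Hence \<open>indicator B\<close> may be replaced by the \<open>F\<close>-measurable \<open>p\<close>.
\<close>

lemma (in prob_space) cond_indep_centered_real:
  fixes Z :: "'a \<Rightarrow> real"
  assumes F: "subalgebra M F" and ind: "cond_indep_vars M F N X I"
    and ij: "i \<in> I" "j \<in> I" "i \<noteq> j"
    and Zm: "Z \<in> borel_measurable (join M F (vimage_algebra (space M) (X j) N))"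
    and Z: "centered M F Z"
  shows "centered M (join M F (vimage_algebra (space M) (X i) N)) Z"
proof -
  interpret sigma_finite_subalgebra M F
    by (rule sigma_finite_subalgebraI[OF F])
  have sp: "space F = space M" and sub: "sets F \<subseteq> sets M"
    using F unfolding subalgebra_def by auto
  have X: "X l \<in> measurable M N" if "l \<in> I" for l
    using ind that unfolding cond_indep_vars_def by blast
  have V: "subalgebra M (vimage_algebra (space M) (X l) N)" if "l \<in> I" for l
    using X[OF that] measurable_sets[OF X[OF that]] unfolding subalgebra_def
    by (auto simp: sets_vimage_algebra2 measurable_space)
  have gen_cases: "\<exists>B0\<in>sets N. B = X l -` B0 \<inter> space M"
    if "B \<in> gen M (X l) N" "l \<in> I" for B l
    using that measurable_space[OF X[OF that(2)]] by (subst (asm) sets_vimage_algebra2) auto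
  have intZ: "integrable M Z"
    using Z unfolding centered_def by simp
  show ?thesis
  proof (rule centered_joinI[OF intZ F V[OF ij(1)]])
    fix A B assume A: "A \<in> sets F" and B: "B \<in> gen M (X i) N"
    have AM: "A \<in> sets M" and BM: "B \<in> sets M"
      using A sub B V[OF ij(1)] unfolding subalgebra_def by auto
    obtain B0 where B0: "B0 \<in> sets N" "B = X i -` B0 \<inter> space M"
      using gen_cases[OF B ij(1)] by blast
    define p where "p = real_cond_exp M F (indicator B)"
    have intB: "integrable M (indicat_real B)"
      using BM emeasure_finite by (simp add: integrable_indicator_iff less_top[symmetric])
    have pF: "p \<in> borel_measurable F"
      unfolding p_def by simp
    have pM [measurable]: "p \<in> borel_measurable M"
      by (rule measurable_from_subalg[OF F pF])
    have p01: "AE w in M. 0 \<le> p w \<and> p w \<le> 1"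
      unfolding p_def using real_cond_exp_ge_c[OF intB, of 0] real_cond_exp_le_c[OF intB, of 1] by auto
    have int_p: "integrable M (\<lambda>w. p w * V w)" if "integrable M V" for V
    proof (rule Bochner_Integration.integrable_bound[OF that])
      have "V \<in> borel_measurable M"
        using that by simp
      then show "(\<lambda>w. p w * V w) \<in> borel_measurable M"
        by measurable
      show "AE w in M. norm (p w * V w) \<le> norm (V w)"
        using p01 by (rule AE_mp) (auto simp: abs_mult mult_left_le_one_le intro!: AE_I2)
    qed
    define H where "H w = indicat_real A w * (indicat_real B w - p w)" for w
    have int_ind: "integrable M (\<lambda>w. indicator C w * V w)"
      if "C \<in> sets M" "integrable M V" for C and V :: "'a \<Rightarrow> real"
      using integrable_mult_indicator[OF that] by simp
    have intp: "integrable M p"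
      using int_p[of "\<lambda>_. 1"] by simp
    have intH: "integrable M H"
      unfolding H_def using intp intB by (intro int_ind[OF AM] Bochner_Integration.integrable_diff)
    have H: "centered M (join M F (vimage_algebra (space M) (X j) N)) H"
    proof (rule centered_joinI[OF intH F V[OF ij(2)]])
      fix A' C assume A': "A' \<in> sets F" and C: "C \<in> gen M (X j) N"
      have CM: "C \<in> sets M"
        using C V[OF ij(2)] unfolding subalgebra_def by auto
      obtain C0 where C0: "C0 \<in> sets N" "C = X j -` C0 \<inter> space M"
        using gen_cases[OF C ij(2)] by blast
      define q where "q = real_cond_exp M F (indicator C)"
      have AA: "A \<inter> A' \<in> sets F" "A \<inter> A' \<in> sets M"
        using A A' sub by auto
      have intC: "integrable M (indicat_real C)" "integrable M (indicat_real (B \<inter> C))"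
        using BM CM emeasure_finite by (auto simp: integrable_indicator_iff less_top[symmetric])
      have intq: "integrable M q"
        unfolding q_def using intC(1) by (rule real_cond_exp_int)
      have factor: "AE w in M. real_cond_exp M F (indicator {w \<in> space M. \<forall>l\<in>K. X l w \<in> C l}) w
          = (\<Prod>l\<in>K. real_cond_exp M F (indicator {w \<in> space M. X l w \<in> C l}) w)"
        if "finite K \<and> K \<noteq> {} \<and> K \<subseteq> I \<and> (\<forall>l\<in>K. C l \<in> sets N)" for K C
        using ind that unfolding cond_indep_vars_def by blast
      have "AE w in M. real_cond_exp M F
          (indicator {w \<in> space M. \<forall>l\<in>{i, j}. X l w \<in> (if l = i then B0 else C0)}) w
        = (\<Prod>l\<in>{i, j}. real_cond_exp M F (indicator {w \<in> space M. X l w \<in> (if l = i then B0 else C0)}) w)"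
        using ij B0(1) C0(1) by (intro factor) auto
      moreover have "{w \<in> space M. \<forall>l\<in>{i, j}. X l w \<in> (if l = i then B0 else C0)} = B \<inter> C"
        "{w \<in> space M. X i w \<in> B0} = B" "{w \<in> space M. X j w \<in> C0} = C"
        using ij(3) B0(2) C0(2) by auto
      ultimately have prod: "AE w in M. real_cond_exp M F (indicator (B \<inter> C)) w = p w * q w"
        using ij(3) unfolding p_def q_def by simp
      have "(LINT w|M. indicator (A \<inter> A') w * indicator (B \<inter> C) w)
          = (LINT w|M. indicator (A \<inter> A') w * real_cond_exp M F (indicator (B \<inter> C)) w)"
        using AA intC(2) by (intro real_cond_exp_intg(2)[symmetric] int_ind) auto
      also have "\<dots> = (LINT w|M. (indicator (A \<inter> A') w * p w) * q w)"
        using prod AA intq by (intro integral_cong_AE) (auto simp: mult.assoc)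
      also have "\<dots> = (LINT w|M. (indicator (A \<inter> A') w * p w) * indicator C w)"
        unfolding q_def
      proof (rule real_cond_exp_intg(2))
        show "integrable M (\<lambda>w. indicator (A \<inter> A') w * p w * indicator C w)"
          using int_ind[OF AA(2) int_p[OF intC(1)]] by (simp add: mult.assoc)
        show "(\<lambda>w. indicator (A \<inter> A') w * p w) \<in> borel_measurable F"
          using AA(1) pF by measurable
      qed (use CM in auto)
      finally have "(LINT w|M. indicator (A \<inter> A') w * indicator (B \<inter> C) w)
          - (LINT w|M. (indicator (A \<inter> A') w * p w) * indicator C w) = 0"
        by simp
      also have "(LINT w|M. indicator (A \<inter> A') w * indicator (B \<inter> C) w)
          - (LINT w|M. (indicator (A \<inter> A') w * p w) * indicator C w)
          = (LINT w|M. indicator (A \<inter> A') w * indicator (B \<inter> C) w - (indicator (A \<inter> A') w * p w) * indicator C w)"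
      proof (rule Bochner_Integration.integral_diff[symmetric])
        show "integrable M (\<lambda>w. indicat_real (A \<inter> A') w * indicat_real (B \<inter> C) w)"
          using int_ind[OF AA(2) intC(2)] .
        show "integrable M (\<lambda>w. indicator (A \<inter> A') w * p w * indicator C w)"
          using int_ind[OF AA(2) int_p[OF intC(1)]] by (simp add: mult.assoc)
      qed
      also have "\<dots> = (LINT w:A' \<inter> C|M. H w)"
        unfolding set_lebesgue_integral_def H_def
        by (intro Bochner_Integration.integral_cong) (auto split: split_indicator)
      finally show "(LINT w:A' \<inter> C|M. H w) = 0" .
    qed
    have intpZ: "integrable M (\<lambda>w. (indicator A w * p w) * Z w)"
      using int_ind[OF AM int_p[OF intZ]] by (simp add: mult.assoc)
    have intABZ: "integrable M (\<lambda>w. indicator (A \<inter> B) w * Z w)"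
      using AM BM by (intro int_ind intZ) auto
    have HZ: "Z w * H w = indicator (A \<inter> B) w * Z w - (indicator A w * p w) * Z w" for w
      unfolding H_def by (auto split: split_indicator simp: algebra_simps)
    have "(LINT w|M. Z w * H w) = 0"
    proof (rule centered_mult_integral_eq_0[OF H _ Zm])
      show "integrable M (\<lambda>w. Z w * H w)"
        unfolding HZ using intABZ intpZ by (rule Bochner_Integration.integrable_diff)
      show "subalgebra M (join M F (vimage_algebra (space M) (X j) N))"
        by (rule subalgebra_join[OF F V[OF ij(2)]])
    qed
    moreover have "(LINT w|M. (indicator A w * p w) * Z w) = 0"
      using A by (intro centered_mult_integral_eq_0[OF Z F _ intpZ] borel_measurable_times
          borel_measurable_indicator pF)
    ultimately have "(LINT w|M. indicator (A \<inter> B) w * Z w) = 0"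
      unfolding HZ Bochner_Integration.integral_diff[OF intABZ intpZ] by simp
    then show "(LINT w:A \<inter> B|M. Z w) = 0"
      unfolding set_lebesgue_integral_def by simp
  qed
qed

lemma subalgebra_vimage:
  assumes X: "X \<in> measurable M N"
  shows "subalgebra M (vimage_algebra (space M) X N)"
  using measurable_space[OF X] measurable_sets[OF X] unfolding subalgebra_def
  by (auto simp: sets_vimage_algebra2)

lemma (in prob_space) cond_indep_centered:
  fixes Z :: "'a \<Rightarrow> 'b::euclidean_space"
  assumes F: "subalgebra M F" and ind: "cond_indep_vars M F N X I"
    and ij: "i \<in> I" "j \<in> I" "i \<noteq> j"
    and Zm: "Z \<in> borel_measurable (join M F (vimage_algebra (space M) (X j) N))"
    and Z: "centered M F Z"
  shows "centered M (join M F (vimage_algebra (space M) (X i) N)) Z"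
proof -
  have intZ: "integrable M Z"
    using Z unfolding centered_def by simp
  have "X i \<in> measurable M N"
    using ind ij(1) unfolding cond_indep_vars_def by blast
  then have sub: "subalgebra M (join M F (vimage_algebra (space M) (X i) N))"
    by (intro subalgebra_join F subalgebra_vimage)
  have "centered M (join M F (vimage_algebra (space M) (X i) N)) (\<lambda>w. Z w \<bullet> b)" if "b \<in> Basis" for b
  proof (rule cond_indep_centered_real[OF F ind ij])
    show "(\<lambda>w. Z w \<bullet> b) \<in> borel_measurable (join M F (vimage_algebra (space M) (X j) N))"
      using Zm by measurable
    show "centered M F (\<lambda>w. Z w \<bullet> b)"
      using Z that centered_iff_components[OF intZ F] by blast
  qed
  then show ?thesis
    using centered_iff_components[OF intZ sub] by blast
qed

section \<open>Randomized quantization with a fresh seed\<close>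

text \<open>
  A seed that is independent of \<open>H\<close> may be integrated out with all \<open>H\<close>-measurable quantities held
  fixed: the joint law of the outcome, seen through \<open>H\<close>, and of the seed is a product measure.
\<close>

lemma (in prob_space) distr_fresh_seed:
  assumes H: "subalgebra M H" and s: "s \<in> measurable M S" "distr M S s = S"
    and ind: "indep_set (sets H) (gen M s S)"
  shows "distr M (restr_to_subalg M H \<Otimes>\<^sub>M S) (\<lambda>w. (w, s w)) = restr_to_subalg M H \<Otimes>\<^sub>M S"
proof -
  define R where "R = restr_to_subalg M H"
  have R: "space R = space M" "sets R = sets H"
    using H unfolding R_def by (simp_all add: space_restr_to_subalg sets_restr_to_subalg)
  have HM: "sets H \<subseteq> sets M"
    using H unfolding subalgebra_def by simp
  have id: "(\<lambda>w. w) \<in> measurable M R"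
  proof (rule measurableI)
    fix A assume "A \<in> sets R"
    then have "A \<in> sets M" using R(2) HM by blast
    then show "(\<lambda>w. w) -` A \<inter> space M \<in> sets M" by simp
  qed (simp add: R)
  interpret R: prob_space R
    unfolding R_def by (rule prob_space_restr_to_subalg[OF H]) unfold_locales
  interpret S: prob_space S
    using prob_space_distr[OF s(1)] s(2) by simp
  have J: "(\<lambda>w. (w, s w)) \<in> measurable M (R \<Otimes>\<^sub>M S)"
    using id s(1) by measurable
  have "R \<Otimes>\<^sub>M S = distr M (R \<Otimes>\<^sub>M S) (\<lambda>w. (w, s w))"
  proof (rule pair_measure_eqI)
    fix A B assume A: "A \<in> sets R" and B: "B \<in> sets S"
    define C where "C = s -` B \<inter> space M"
    have AM: "A \<in> sets M" and CM: "C \<in> sets M"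
      using A R(2) HM measurable_sets[OF s(1) B] unfolding C_def by auto
    have C: "C \<in> gen M s S"
      unfolding C_def using B by (rule in_vimage_algebra)
    have "emeasure (distr M (R \<Otimes>\<^sub>M S) (\<lambda>w. (w, s w))) (A \<times> B) = emeasure M (A \<inter> C)"
    proof -
      have "(\<lambda>w. (w, s w)) -` (A \<times> B) \<inter> space M = A \<inter> C"
        using sets.sets_into_space[OF AM] unfolding C_def by auto
      then show ?thesis
        using A B by (simp add: emeasure_distr[OF J])
    qed
    also have "\<dots> = emeasure M A * emeasure M C"
      using indep_setD[OF ind _ C, of A] A R(2)
      by (simp add: emeasure_eq_measure ennreal_mult)
    also have "emeasure M A = emeasure R A"
      using emeasure_restr_to_subalg[OF H, of A] A R(2) unfolding R_def by simp
    also have "emeasure M C = emeasure S B"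
      unfolding C_def using emeasure_distr[OF s(1) B] s(2) by simp
    finally show "emeasure R A * emeasure S B = emeasure (distr M (R \<Otimes>\<^sub>M S) (\<lambda>w. (w, s w))) (A \<times> B)"
      by simp
  qed (unfold_locales, simp)
  then show ?thesis
    unfolding R_def by simp
qed

text \<open>
  With the seed integrated out, the bias and the variance of the quantizer at the frozen input are
  those that its definition prescribes. In particular the error remains centered given any
  information \<open>H\<close> that does not involve its own seed, not only given the input.
\<close>

lemma (in prob_space) quantization_error:
  fixes Q :: "'b::euclidean_space \<Rightarrow> 's \<Rightarrow> 'b"
  assumes H: "subalgebra M H" and s: "s \<in> measurable M S" "distr M S s = S"
    and ind: "indep_set (sets H) (gen M s S)"
    and Q: "quantization_operator S \<omega> Q" and "\<omega> > 0"
    and yH: "y \<in> borel_measurable H" and y: "square_integrable M y"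
  defines "q \<equiv> \<lambda>w. Q (y w) (s w) - y w"
  shows square_integrable_quantization_error: "square_integrable M q"
    and centered_quantization_error: "centered M H q"
    and quantization_error_le: "\<And>A. A \<in> sets H \<Longrightarrow>
      (LINT w:A|M. (norm (q w))\<^sup>2) \<le> \<omega> * (LINT w:A|M. (norm (y w))\<^sup>2)"
proof -
  define R where "R = restr_to_subalg M H"
  have R: "space R = space M" "sets R = sets H"
    using H unfolding R_def by (simp_all add: space_restr_to_subalg sets_restr_to_subalg)
  interpret R: prob_space R
    unfolding R_def by (rule prob_space_restr_to_subalg[OF H]) unfold_locales
  interpret S: prob_space S
    using Q unfolding quantization_operator_def by blast
  interpret RS: pair_sigma_finite R S ..
  have HM: "A \<in> sets M" if "A \<in> sets H" for A
    using H that unfolding subalgebra_def by blast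
  have [measurable]: "case_prod Q \<in> measurable (borel \<Otimes>\<^sub>M S) borel"
    using Q unfolding quantization_operator_def by blast
  have yH_meas: "(\<lambda>w. indicator A w * ennreal (\<omega> * (norm (y w))\<^sup>2)) \<in> borel_measurable H"
    if "A \<in> sets H" for A
    using that yH by measurable
  have yR [measurable]: "y \<in> borel_measurable R"
    using measurable_in_subalg[OF H yH] unfolding R_def .
  define \<phi> where "\<phi> = (\<lambda>(w, t). Q (y w) t - y w)"
  have \<phi> [measurable]: "\<phi> \<in> borel_measurable (R \<Otimes>\<^sub>M S)"
    unfolding \<phi>_def by measurable
  define J where "J = (\<lambda>w. (w, s w))"
  have dJ: "distr M (R \<Otimes>\<^sub>M S) J = R \<Otimes>\<^sub>M S"
    unfolding R_def J_def by (rule distr_fresh_seed[OF H s ind])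
  have "(\<lambda>w. w) \<in> measurable M R"
    by (rule measurableI) (use HM R in \<open>auto simp: measurable_sets\<close>)
  then have J [measurable]: "J \<in> measurable M (R \<Otimes>\<^sub>M S)"
    unfolding J_def using s(1) by measurable
  have qJ: "q w = \<phi> (J w)" for w
    unfolding q_def \<phi>_def J_def by simp
  have qM [measurable]: "q \<in> borel_measurable M"
    unfolding qJ[abs_def] by measurable
  have inner: "(\<integral>\<^sup>+ t. ennreal ((norm (\<phi> (w, t)))\<^sup>2) \<partial>S) \<le> ennreal (\<omega> * (norm (y w))\<^sup>2)" for w
    using Q unfolding quantization_operator_def \<phi>_def
    by (simp add: nn_integral_eq_integral ennreal_leI)
  have nn: "(\<integral>\<^sup>+ w. indicator A w * ennreal ((norm (q w))\<^sup>2) \<partial>M)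
      \<le> (\<integral>\<^sup>+ w. indicator A w * ennreal (\<omega> * (norm (y w))\<^sup>2) \<partial>M)" if A: "A \<in> sets H" for A
  proof -
    have [measurable]: "A \<in> sets R"
      using A R(2) by simp
    have "(\<integral>\<^sup>+ w. indicator A w * ennreal ((norm (q w))\<^sup>2) \<partial>M)
        = (\<integral>\<^sup>+ w. (\<lambda>p. indicator A (fst p) * ennreal ((norm (\<phi> p))\<^sup>2)) (J w) \<partial>M)"
      unfolding qJ by (simp add: J_def)
    also have "\<dots> = (\<integral>\<^sup>+ p. indicator A (fst p) * ennreal ((norm (\<phi> p))\<^sup>2) \<partial>(R \<Otimes>\<^sub>M S))"
      by (subst dJ[symmetric], subst nn_integral_distr) auto
    also have "\<dots> = (\<integral>\<^sup>+ w. \<integral>\<^sup>+ t. indicator A w * ennreal ((norm (\<phi> (w, t)))\<^sup>2) \<partial>S \<partial>R)"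
      by (subst S.nn_integral_fst[symmetric]) auto
    also have "\<dots> = (\<integral>\<^sup>+ w. indicator A w * (\<integral>\<^sup>+ t. ennreal ((norm (\<phi> (w, t)))\<^sup>2) \<partial>S) \<partial>R)"
      by (intro nn_integral_cong nn_integral_cmult) measurable
    also have "\<dots> \<le> (\<integral>\<^sup>+ w. indicator A w * ennreal (\<omega> * (norm (y w))\<^sup>2) \<partial>R)"
      using inner by (intro nn_integral_mono mult_left_mono) auto
    also have "\<dots> = (\<integral>\<^sup>+ w. indicator A w * ennreal (\<omega> * (norm (y w))\<^sup>2) \<partial>M)"
      unfolding R_def by (rule nn_integral_subalgebra2[OF H yH_meas[OF A]])
    finally show ?thesis .
  qed
  have int_y: "integrable M (\<lambda>w. \<omega> * (norm (y w))\<^sup>2)"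
    using square_integrable_norm[OF y] by simp
  have int_q: "integrable M (\<lambda>w. (norm (q w))\<^sup>2)"
  proof (rule integrableI_bounded)
    have "space M \<in> sets H"
      using H sets.top[of H] unfolding subalgebra_def by simp
    from nn[OF this] have "(\<integral>\<^sup>+ w. ennreal ((norm (q w))\<^sup>2) \<partial>M) \<le> (\<integral>\<^sup>+ w. ennreal (\<omega> * (norm (y w))\<^sup>2) \<partial>M)"
      by (simp cong: nn_integral_cong_simp)
    also have "\<dots> < \<infinity>"
      using int_y \<open>\<omega> > 0\<close> by (subst nn_integral_eq_integral) auto
    finally show "(\<integral>\<^sup>+ w. ennreal (norm ((norm (q w))\<^sup>2)) \<partial>M) < \<infinity>"
      by simp
  qed measurable
  show q: "square_integrable M q"
    unfolding square_integrable_def using int_q by simp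
  show "(LINT w:A|M. (norm (q w))\<^sup>2) \<le> \<omega> * (LINT w:A|M. (norm (y w))\<^sup>2)" if A: "A \<in> sets H" for A
  proof -
    have eq: "(\<integral>\<^sup>+ w. indicator A w * ennreal (V w) \<partial>M) = ennreal (LINT w:A|M. V w)"
      if "integrable M V" "\<And>w. 0 \<le> V w" for V
    proof -
      have "(\<integral>\<^sup>+ w. indicator A w * ennreal (V w) \<partial>M) = (\<integral>\<^sup>+ w. ennreal (indicator A w *\<^sub>R V w) \<partial>M)"
        by (intro nn_integral_cong) (auto split: split_indicator)
      then show ?thesis
        unfolding set_lebesgue_integral_def
        using integrable_mult_indicator[OF HM[OF A] that(1)] that(2)
        by (simp add: nn_integral_eq_integral)
    qed
    have "ennreal (LINT w:A|M. (norm (q w))\<^sup>2) \<le> ennreal (LINT w:A|M. \<omega> * (norm (y w))\<^sup>2)"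
      using nn[OF A] \<open>\<omega> > 0\<close> by (subst (asm) eq[OF int_q], simp, subst (asm) eq[OF int_y]) auto
    moreover have "0 \<le> (LINT w:A|M. \<omega> * (norm (y w))\<^sup>2)"
      unfolding set_lebesgue_integral_def using \<open>\<omega> > 0\<close>
      by (intro Bochner_Integration.integral_nonneg) simp
    ultimately show ?thesis
      by (simp add: ennreal_le_iff)
  qed
  have int_q1: "integrable M q"
    by (rule square_integrable_integrable[OF q])
  show "centered M H q"
    unfolding centered_def
  proof (intro conjI ballI int_q1)
    fix A assume A: "A \<in> sets H"
    then have [measurable]: "A \<in> sets R"
      using R(2) by simp
    define \<Psi> where "\<Psi> p = indicat_real A (fst p) *\<^sub>R \<phi> p" for p
    have [measurable]: "\<Psi> \<in> borel_measurable (R \<Otimes>\<^sub>M S)"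
      unfolding \<Psi>_def by measurable
    have \<Psi>J: "\<Psi> (J w) = indicator A w *\<^sub>R q w" for w
      unfolding \<Psi>_def qJ by (simp add: J_def)
    have int: "integrable M (\<lambda>w. \<Psi> (J w))"
      unfolding \<Psi>J using integrable_mult_indicator[OF HM[OF A] int_q1] .
    then have int': "integrable (R \<Otimes>\<^sub>M S) \<Psi>"
      by (subst dJ[symmetric], subst integrable_distr_eq) auto
    have "(LINT w:A|M. q w) = (LINT w|M. \<Psi> (J w))"
      unfolding set_lebesgue_integral_def \<Psi>J ..
    also have "\<dots> = integral\<^sup>L (R \<Otimes>\<^sub>M S) \<Psi>"
      using integral_distr[OF J, of \<Psi>] dJ by simp
    also have "\<dots> = (LINT w|R. LINT t|S. \<Psi> (w, t))"
      by (rule RS.integral_fst'[OF int', symmetric])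
    also have "\<dots> = 0"
    proof -
      have "(LINT t|S. Q u t - u) = 0" for u
        using Q unfolding quantization_operator_def by (simp add: S.prob_space)
      then have "(LINT t|S. \<Psi> (w, t)) = 0" for w
        unfolding \<Psi>_def \<phi>_def by simp
      then show ?thesis by simp
    qed
    finally show "(LINT w:A|M. q w) = 0" .
  qed
qed

section \<open>The iterates and their filtration\<close>

locale dqsgd = convex_smooth_mean f n L \<mu> xs + prob_space M
  for f :: "nat \<Rightarrow> 'a::euclidean_space \<Rightarrow> real" and n :: nat and L \<mu> :: real and xs :: 'a
    and M :: "'w measure" +
  fixes Q :: "'a \<Rightarrow> 's \<Rightarrow> 'a" and N :: "'z measure" and S :: "'s measure"
    and \<tau> :: nat and \<omega> \<gamma> :: real and Dw :: "nat \<Rightarrow> real" and x0 :: 'a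
    and smp :: "nat \<Rightarrow> nat \<Rightarrow> 'w \<Rightarrow> 'z" and seed :: "nat \<Rightarrow> nat \<Rightarrow> 'w \<Rightarrow> 's"
    and ghat g e :: "nat \<Rightarrow> nat \<Rightarrow> 'w \<Rightarrow> 'a" and x :: "nat \<Rightarrow> 'w \<Rightarrow> 'a"
  assumes tau_pos: "\<tau> \<ge> 1" and omega_pos: "\<omega> > 0" and Q: "quantization_operator S \<omega> Q"
    and alg: "D_QSGDstar M N S n f xs Q Dw \<gamma> \<tau> x0 smp seed ghat g x e"
begin

abbreviation F :: "nat \<Rightarrow> 'w measure" where "F \<equiv> history M N S n smp seed x"

definition gm :: "nat \<Rightarrow> 'w \<Rightarrow> 'a" where "gm k w = (1 / real n) *\<^sub>R (\<Sum>i<n. g i k w)"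
definition em :: "nat \<Rightarrow> 'w \<Rightarrow> 'a" where "em k w = (1 / real n) *\<^sub>R (\<Sum>i<n. e i k w)"

lemma framework: "delayed_framework n \<gamma> \<tau> x0 g x e"
  using alg unfolding D_QSGDstar_def by blast

lemma g_eq: "i < n \<Longrightarrow> g i k w = Q (ghat i k w - grad (f i) xs) (seed i k w)"
  using alg unfolding D_QSGDstar_def by blast

lemma cond_indep_samples: "cond_indep_vars M (F k) N (\<lambda>i. smp i k) {..<n}"
  and ghat_join: "i < n \<Longrightarrow> ghat i k \<in> borel_measurable (join M (F k) (vimage_algebra (space M) (smp i k) N))"
  and ghat_cond_exp: "i < n \<Longrightarrow> has_cond_exp M (F k) (ghat i k) (\<lambda>w. grad (f i) (x k w))"
  and ghat_cond_var: "i < n \<Longrightarrow>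
    cond_exp_le M (F k) (\<lambda>w. (norm (ghat i k w - grad (f i) (x k w)))\<^sup>2) (\<lambda>w. Dw i)"
  and seed_measurable: "i < n \<Longrightarrow> seed i k \<in> measurable M S"
  and seed_distr: "i < n \<Longrightarrow> distr M S (seed i k) = S"
  and seeds_indep: "indep_sets
          (case_nat (sigma_sets (space M) (sets (F k) \<union> (\<Union>i<n. gen M (smp i k) N)))
                    (\<lambda>i. gen M (seed i k) S)) {..n}"
  using alg unfolding D_QSGDstar_def Let_def by blast+

lemma smp_measurable: "i < n \<Longrightarrow> smp i k \<in> measurable M N"
  using cond_indep_samples unfolding cond_indep_vars_def by blast

lemma mean_delayed_update:
  "(1 / real n) *\<^sub>R (\<Sum>i<n. delayed_update \<gamma> \<tau> g i k w) = (if k \<ge> \<tau> then \<gamma> *\<^sub>R gm (k - \<tau>) w else 0)"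
  unfolding delayed_update_def gm_def by (simp add: scaleR_sum_right[symmetric] mult.commute)

lemma x_eq: "x k w = x0 - \<gamma> *\<^sub>R (\<Sum>t<k - \<tau>. gm t w)"
proof (induction k)
  case 0
  then show ?case using framework unfolding delayed_framework_def by simp
next
  case (Suc k)
  have "x (Suc k) w = x k w - (if k \<ge> \<tau> then \<gamma> *\<^sub>R gm (k - \<tau>) w else 0)"
    using framework unfolding delayed_framework_def mean_delayed_update by blast
  then show ?case
    using Suc by (auto simp: Suc_diff_le scaleR_add_right)
qed

lemma em_eq: "em k w = \<gamma> *\<^sub>R (\<Sum>t\<in>{k - \<tau>..<k}. gm t w)"
proof (induction k)
  case 0
  have "\<And>i. i < n \<Longrightarrow> e i 0 w = 0"
    using framework unfolding delayed_framework_def by blast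
  then show ?case unfolding em_def by simp
next
  case (Suc k)
  have "(\<Sum>i<n. e i (Suc k) w) = (\<Sum>i<n. e i k w + \<gamma> *\<^sub>R g i k w - delayed_update \<gamma> \<tau> g i k w)"
    using framework unfolding delayed_framework_def by (intro sum.cong) auto
  then have "em (Suc k) w = em k w + \<gamma> *\<^sub>R gm k w - (1 / real n) *\<^sub>R (\<Sum>i<n. delayed_update \<gamma> \<tau> g i k w)"
    unfolding em_def gm_def
    by (simp add: sum.distrib sum_subtractf scaleR_add_right scaleR_diff_right
        scaleR_sum_right[symmetric] mult.commute)
  then have rec: "em (Suc k) w = em k w + \<gamma> *\<^sub>R gm k w - (if k \<ge> \<tau> then \<gamma> *\<^sub>R gm (k - \<tau>) w else 0)"
    unfolding mean_delayed_update .
  show ?case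
  proof (cases "k \<ge> \<tau>")
    case True
    have "(\<Sum>t\<in>{k - \<tau>..<Suc k}. gm t w) = gm (k - \<tau>) w + (\<Sum>t\<in>{Suc k - \<tau>..<Suc k}. gm t w)"
      using True tau_pos by (subst sum.atLeast_Suc_lessThan) (auto simp: Suc_diff_le)
    moreover have "(\<Sum>t\<in>{k - \<tau>..<Suc k}. gm t w) = (\<Sum>t\<in>{k - \<tau>..<k}. gm t w) + gm k w"
      by (rule sum.atLeastLessThan_Suc) simp
    ultimately have "(\<Sum>t\<in>{Suc k - \<tau>..<Suc k}. gm t w) = (\<Sum>t\<in>{k - \<tau>..<k}. gm t w) + gm k w - gm (k - \<tau>) w"
      by (simp add: algebra_simps)
    then show ?thesis
      using rec Suc True by (simp add: scaleR_add_right scaleR_diff_right)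
  next
    case False
    then have "k - \<tau> = 0" "Suc k - \<tau> = 0"
      by auto
    then show ?thesis
      using rec Suc False by (simp add: scaleR_add_right)
  qed
qed

lemma x_minus_em: "x k w - em k w = x0 - \<gamma> *\<^sub>R (\<Sum>t<k. gm t w)"
proof -
  have "(\<Sum>t<k. gm t w) = (\<Sum>t<k - \<tau>. gm t w) + (\<Sum>t\<in>{k - \<tau>..<k}. gm t w)"
    unfolding lessThan_atLeast0 by (rule sum.atLeastLessThan_concat[symmetric]) auto
  then show ?thesis
    unfolding x_eq em_eq by (simp add: scaleR_add_right)
qed

lemma ghat_measurable: "i < n \<Longrightarrow> ghat i k \<in> borel_measurable M"
  using ghat_cond_exp[of i k] unfolding has_cond_exp_def by (simp add: borel_measurable_integrable)

lemma measurable_g_sub: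
  assumes "i < n" and G: "ghat i k \<in> borel_measurable G" "seed i k \<in> measurable G S"
  shows "g i k \<in> borel_measurable G"
proof -
  have [measurable]: "case_prod Q \<in> measurable (borel \<Otimes>\<^sub>M S) borel"
    using Q unfolding quantization_operator_def by blast
  have "(\<lambda>w. case_prod Q (ghat i k w - grad (f i) xs, seed i k w)) \<in> borel_measurable G"
    using G by measurable
  then show ?thesis
    using g_eq[OF assms(1)] by (simp cong: measurable_cong)
qed

lemma g_measurable: "i < n \<Longrightarrow> g i k \<in> borel_measurable M"
  by (intro measurable_g_sub ghat_measurable seed_measurable)

lemma measurable_gm_sub:
  assumes "\<And>i. i < n \<Longrightarrow> g i k \<in> borel_measurable G"
  shows "gm k \<in> borel_measurable G"
  unfolding gm_def[abs_def] using assms by (intro borel_measurable_scaleR borel_measurable_sum) auto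

lemma measurable_x_sub:
  assumes "\<And>t. t < k - \<tau> \<Longrightarrow> gm t \<in> borel_measurable G"
  shows "x k \<in> borel_measurable G"
  unfolding x_eq[abs_def] using assms
  by (intro borel_measurable_diff borel_measurable_scaleR borel_measurable_sum borel_measurable_const) auto

lemma gm_measurable: "gm k \<in> borel_measurable M"
  by (intro measurable_gm_sub g_measurable)

lemma x_measurable [measurable]: "x k \<in> borel_measurable M"
  by (intro measurable_x_sub gm_measurable)

definition randomness :: "nat \<Rightarrow> 'w set set" where
  "randomness k = (\<Union>t<k. \<Union>i<n. gen M (smp i t) N \<union> gen M (seed i t) S)"

lemma randomness_sets: "randomness k \<subseteq> sets M"
  using subalgebra_vimage[OF smp_measurable] subalgebra_vimage[OF seed_measurable]
  unfolding randomness_def subalgebra_def by blast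

lemma gen_x_sets: "gen M (x k) borel \<subseteq> sets M"
  using subalgebra_vimage[OF x_measurable] unfolding subalgebra_def by blast

lemma F_eq: "F k = sigma (space M) (gen M (x k) borel \<union> randomness k)"
  unfolding history_def randomness_def ..

lemma subalgebra_F: "subalgebra M (F k)"
  unfolding F_eq using randomness_sets gen_x_sets by (intro subalgebra_sigma) simp

lemma space_F: "space (F k) = space M" and sets_F: "A \<in> sets (F k) \<Longrightarrow> A \<in> sets M"
  using subalgebra_F unfolding subalgebra_def by auto

lemma measurable_gen:
  assumes "gen M X N' \<subseteq> sets G" "space G = space M" "X \<in> measurable M N'"
  shows "X \<in> measurable G N'"
proof (rule measurable_from_subalg)
  show "subalgebra G (vimage_algebra (space M) X N')"
    using assms unfolding subalgebra_def by simp
  show "X \<in> measurable (vimage_algebra (space M) X N') N'"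
    using measurable_space[OF assms(3)] by (intro measurable_vimage_algebra1) auto
qed

lemma randomness_F: "randomness k \<subseteq> sets (F k)" and gen_x_F: "gen M (x k) borel \<subseteq> sets (F k)"
proof -
  have "gen M (x k) borel \<union> randomness k \<subseteq> Pow (space M)"
    using randomness_sets[of k] gen_x_sets[of k] sets.space_closed[of M] by blast
  then show "randomness k \<subseteq> sets (F k)" "gen M (x k) borel \<subseteq> sets (F k)"
    unfolding F_eq using sets_sigma_superset by blast+
qed

lemma x_F: "x k \<in> borel_measurable (F k)"
  by (rule measurable_gen[OF gen_x_F space_F x_measurable])

text \<open>
  The iterates are functions of the samples and seeds of earlier steps, so that the point \<open>x k\<close>
  itself contributes nothing to the past at step \<open>k\<close>; hence the pasts are increasing.
\<close>

lemma F_eq_randomness: "sets (F k) = sets (sigma (space M) (randomness k))"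
proof (induction k rule: less_induct)
  case (less k)
  define G where "G = sigma (space M) (randomness k)"
  have G: "space G = space M" "randomness k \<subseteq> sets G"
    using randomness_sets[of k] sets.space_closed[of M] unfolding G_def
    by (auto simp: space_measure_of_conv)
  have g: "g i t \<in> borel_measurable G" if t: "t < k" and i: "i < n" for i t
  proof (rule measurable_g_sub[OF i])
    have "randomness t \<subseteq> randomness k"
      using t unfolding randomness_def by (intro UN_mono) auto
    then have "sets (F t) \<subseteq> sets G"
      unfolding less.IH[OF t] using G by (intro sets_sigma_mono) auto
    moreover have gens: "gen M (smp i t) N \<subseteq> sets G" "gen M (seed i t) S \<subseteq> sets G"
      using t i G(2) unfolding randomness_def by auto
    ultimately have "sets (join M (F t) (vimage_algebra (space M) (smp i t) N)) \<subseteq> sets G"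
      using G(1) by (intro sets_sigma_mono) auto
    then have "subalgebra G (join M (F t) (vimage_algebra (space M) (smp i t) N))"
      using G(1) unfolding subalgebra_def by (simp add: space_measure_of_conv)
    then show "ghat i t \<in> borel_measurable G"
      using ghat_join[OF i] by (rule measurable_from_subalg)
    show "seed i t \<in> measurable G S"
      by (rule measurable_gen[OF gens(2) G(1) seed_measurable[OF i]])
  qed
  have "x k \<in> borel_measurable G"
    using g by (intro measurable_x_sub measurable_gm_sub) auto
  then have "gen M (x k) borel \<subseteq> sets G"
    using G(1) by (intro sets_image_in_sets) auto
  then have "sets (F k) \<subseteq> sets G"
    unfolding F_eq using G by (intro sets_sigma_mono) auto
  moreover have "sets G \<subseteq> sets (F k)"
    unfolding G_def by (intro sets_sigma_mono randomness_F space_F)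
  ultimately show ?case
    unfolding G_def by blast
qed

lemma F_mono:
  assumes "j \<le> k" shows "sets (F j) \<subseteq> sets (F k)"
proof -
  have "randomness j \<subseteq> randomness k"
    using assms unfolding randomness_def by (intro UN_mono) auto
  then show ?thesis
    unfolding F_eq_randomness[of j] using randomness_F[of k]
    by (intro sets_sigma_mono space_F) auto
qed

lemma subalgebra_F_F: "j \<le> k \<Longrightarrow> subalgebra (F k) (F j)"
  using F_mono unfolding subalgebra_def by (simp add: space_F)

lemma g_F:
  assumes t: "t < k" and i: "i < n"
  shows "g i t \<in> borel_measurable (F k)"
proof (rule measurable_g_sub[OF i])
  have gens: "gen M (smp i t) N \<subseteq> sets (F k)" "gen M (seed i t) S \<subseteq> sets (F k)"
    using t i randomness_F[of k] unfolding randomness_def by auto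
  then have "sets (join M (F t) (vimage_algebra (space M) (smp i t) N)) \<subseteq> sets (F k)"
    using F_mono[of t k] t by (intro sets_sigma_mono space_F) auto
  then have "subalgebra (F k) (join M (F t) (vimage_algebra (space M) (smp i t) N))"
    unfolding subalgebra_def by (simp add: space_measure_of_conv space_F)
  then show "ghat i t \<in> borel_measurable (F k)"
    using ghat_join[OF i] by (rule measurable_from_subalg)
  show "seed i t \<in> measurable (F k) S"
    by (rule measurable_gen[OF gens(2) space_F seed_measurable[OF i]])
qed

lemma gm_F: "t < k \<Longrightarrow> gm t \<in> borel_measurable (F k)"
  by (intro measurable_gm_sub g_F)

text \<open>Because of the delay, a point depends only on what was known \<open>\<tau>\<close> steps earlier.\<close>

lemma x_F_delayed: "t - \<tau> \<le> s \<Longrightarrow> x t \<in> borel_measurable (F s)"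
  by (intro measurable_x_sub gm_F) auto

section \<open>The variance of the averaged stochastic vector\<close>

definition past_families :: "nat \<Rightarrow> nat \<Rightarrow> 'w set set" where
  "past_families k = case_nat (sigma_sets (space M) (sets (F k) \<union> (\<Union>i<n. gen M (smp i k) N)))
                              (\<lambda>i. gen M (seed i k) S)"

text \<open>
  Leaving out only the seed of worker \<open>i\<close> keeps this sigma-algebra independent of that seed, while the
  sampling errors of all workers and the quantization errors of all other workers are measurable
  for it.
\<close>

definition others :: "nat \<Rightarrow> nat \<Rightarrow> 'w measure" where
  "others i k = sigma (space M) (\<Union>l\<in>{..n} - {Suc i}. past_families k l)"

lemma past_families_sets: "l \<in> {..n} \<Longrightarrow> past_families k l \<subseteq> sets M"
  using seeds_indep[of k] unfolding indep_sets_def past_families_def by (elim conjE) (rule bspec)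

lemma Int_stable_past_families:
  assumes "l \<in> {..n}"
  shows "Int_stable (past_families k l)"
proof (cases l)
  case 0
  have "sets (F k) \<union> (\<Union>i<n. gen M (smp i k) N) \<subseteq> Pow (space M)"
    using sets.space_closed[of "F k"] sets.space_closed[of "vimage_algebra (space M) _ N"]
    by (intro Un_least UN_least) (simp_all add: space_F)
  then have "past_families k l = sets (sigma (space M) (sets (F k) \<union> (\<Union>i<n. gen M (smp i k) N)))"
    unfolding past_families_def 0 by simp
  then show ?thesis
    unfolding Int_stable_def by auto
next
  case (Suc i)
  then show ?thesis
    unfolding past_families_def Int_stable_def by auto
qed

lemma seed_indep_others:
  assumes i: "i < n"
  shows "indep_set (sets (others i k)) (gen M (seed i k) S)"
proof -
  define I where "I = case_bool ({..n} - {Suc i}) {Suc i}"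
  have "indep_sets (\<lambda>b. sigma_sets (space M) (\<Union>l\<in>I b. past_families k l)) UNIV"
  proof (rule indep_sets_collect_sigma)
    have "(\<Union>b\<in>UNIV. I b) = {..n}"
      using i unfolding I_def UNIV_bool by auto
    then show "indep_sets (past_families k) (\<Union>b\<in>UNIV. I b)"
      using seeds_indep[of k] unfolding past_families_def by simp
    show "disjoint_family_on I UNIV"
      unfolding I_def disjoint_family_on_def by (auto split: bool.splits)
    show "Int_stable (past_families k l)" if "b \<in> UNIV" "l \<in> I b" for b l
      using that i unfolding I_def by (intro Int_stable_past_families) (auto split: bool.splits)
  qed
  moreover have "sigma_sets (space M) (\<Union>l\<in>I True. past_families k l) = sets (others i k)"
  proof -
    have "(\<Union>l\<in>{..n} - {Suc i}. past_families k l) \<subseteq> Pow (space M)"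
      using past_families_sets[of _ k] sets.space_closed[of M] by fastforce
    then show ?thesis
      unfolding I_def others_def by simp
  qed
  moreover have "sigma_sets (space M) (\<Union>l\<in>I False. past_families k l) = gen M (seed i k) S"
    using sets.sigma_sets_eq[of "vimage_algebra (space M) (seed i k) S"]
    unfolding I_def past_families_def by simp
  ultimately show ?thesis
    unfolding indep_set_def
    by (elim indep_sets_mono_sets) (auto split: bool.splits)
qed

lemma subalgebra_others: "subalgebra M (others i k)"
  unfolding others_def using past_families_sets by (intro subalgebra_sigma) blast

lemma space_others: "space (others i k) = space M"
  using subalgebra_others unfolding subalgebra_def by simp

lemma past_families_others: "l \<in> {..n} - {Suc i} \<Longrightarrow> past_families k l \<subseteq> sets (others i k)"
proof -
  assume l: "l \<in> {..n} - {Suc i}"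
  have "(\<Union>l\<in>{..n} - {Suc i}. past_families k l) \<subseteq> Pow (space M)"
    using past_families_sets[of _ k] sets.space_closed[of M] by fastforce
  then show ?thesis
    unfolding others_def using l sets_sigma_superset by blast
qed

lemma subalgebra_others_join:
  assumes j: "j < n"
  shows "subalgebra (others i k) (join M (F k) (vimage_algebra (space M) (smp j k) N))"
proof -
  have "sets (F k) \<union> gen M (smp j k) N \<subseteq> past_families k 0"
    using j unfolding past_families_def by (auto intro: sigma_sets.Basic)
  also have "\<dots> \<subseteq> sets (others i k)"
    by (rule past_families_others) simp
  finally have "sets (join M (F k) (vimage_algebra (space M) (smp j k) N)) \<subseteq> sets (others i k)"
    by (intro sets_sigma_mono space_others)
  then show ?thesis
    unfolding subalgebra_def by (simp add: space_others space_measure_of_conv)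
qed

lemma subalgebra_join_smp: "j < n \<Longrightarrow> subalgebra M (join M (F k) (vimage_algebra (space M) (smp j k) N))"
  by (intro subalgebra_join subalgebra_F subalgebra_vimage smp_measurable)

lemma subalgebra_join_F:
  assumes j: "j < n"
  shows "subalgebra (join M (F k) (vimage_algebra (space M) (smp j k) N)) (F k)"
  using sets_join_superset(1)[OF subalgebra_F[of k] subalgebra_vimage[OF smp_measurable[OF j]]]
  unfolding subalgebra_def by (simp add: space_measure_of_conv space_F)

lemma sets_F_others: "sets (F k) \<subseteq> sets (others i k)"
  using subalgebra_join_F[of 0 k] subalgebra_others_join[of 0 i k] n_pos
  unfolding subalgebra_def by auto

lemma seed_others:
  assumes "j < n" "j \<noteq> i"
  shows "seed j k \<in> measurable (others i k) S"
proof (rule measurable_gen[OF _ space_others seed_measurable[OF assms(1)]])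
  show "gen M (seed j k) S \<subseteq> sets (others i k)"
    using past_families_others[of "Suc j" i k] assms unfolding past_families_def by simp
qed

lemma ghat_others: "j < n \<Longrightarrow> ghat j k \<in> borel_measurable (others i k)"
  by (rule measurable_from_subalg[OF subalgebra_others_join ghat_join])

lemma g_others: "j < n \<Longrightarrow> j \<noteq> i \<Longrightarrow> g j k \<in> borel_measurable (others i k)"
  by (intro measurable_g_sub ghat_others seed_others)

text \<open>
  The stochastic vector of a worker is the sum of a shifted gradient, of the sampling error
  \<open>\<delta>\<close> and of the quantization error \<open>q\<close> of the input \<open>y\<close>.
\<close>

definition \<alpha> :: "nat \<Rightarrow> nat \<Rightarrow> 'w \<Rightarrow> 'a" where "\<alpha> i k w = grad (f i) (x k w) - grad (f i) xs"
definition \<delta> :: "nat \<Rightarrow> nat \<Rightarrow> 'w \<Rightarrow> 'a" where "\<delta> i k w = ghat i k w - grad (f i) (x k w)"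
definition y :: "nat \<Rightarrow> nat \<Rightarrow> 'w \<Rightarrow> 'a" where "y i k w = ghat i k w - grad (f i) xs"
definition q :: "nat \<Rightarrow> nat \<Rightarrow> 'w \<Rightarrow> 'a" where "q i k w = g i k w - y i k w"
definition noise :: "nat \<Rightarrow> 'w \<Rightarrow> 'a" where "noise k w = gm k w - grad h (x k w)"
definition gap :: "nat \<Rightarrow> 'w \<Rightarrow> real" where "gap k w = h (x k w) - h xs"
definition D1 :: real where "D1 = (\<omega> + 1) * ((1 / real n) * (\<Sum>i<n. Dw i)) / real n"

lemma y_eq: "y i k w = \<delta> i k w + \<alpha> i k w"
  unfolding y_def \<delta>_def \<alpha>_def by simp

lemma noise_eq: "noise k w = (1 / real n) *\<^sub>R (\<Sum>i<n. \<delta> i k w + q i k w)"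
proof -
  have "g i k w = (\<delta> i k w + q i k w) + (grad (f i) (x k w) - grad (f i) xs)" for i
    unfolding q_def y_def \<delta>_def by simp
  then have "gm k w = (1 / real n) *\<^sub>R (\<Sum>i<n. (\<delta> i k w + q i k w) + (grad (f i) (x k w) - grad (f i) xs))"
    unfolding gm_def by simp
  also have "\<dots> = (1 / real n) *\<^sub>R (\<Sum>i<n. \<delta> i k w + q i k w) + grad h (x k w)"
    unfolding grad_h_diff by (simp only: sum.distrib[of "\<lambda>i. \<delta> i k w + q i k w"] scaleR_add_right)
  finally show ?thesis
    unfolding noise_def by simp
qed

lemma alpha_F: "i < n \<Longrightarrow> \<alpha> i k \<in> borel_measurable (F k)"
  unfolding \<alpha>_def[abs_def]
  by (intro borel_measurable_diff borel_measurable_const measurable_compose[OF x_F grad_f_measurable])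

lemma grad_h_F: "(\<lambda>w. grad h (x k w)) \<in> borel_measurable (F k)"
  by (rule measurable_compose[OF x_F grad_h_measurable])

lemma delta_join:
  assumes "i < n"
  shows "\<delta> i k \<in> borel_measurable (join M (F k) (vimage_algebra (space M) (smp i k) N))"
proof -
  have "(\<lambda>w. grad (f i) (x k w)) \<in> borel_measurable (F k)"
    by (rule measurable_compose[OF x_F grad_f_measurable[OF assms]])
  then show ?thesis
    unfolding \<delta>_def[abs_def]
    by (intro borel_measurable_diff ghat_join[OF assms] measurable_from_subalg[OF subalgebra_join_F[OF assms]])
qed

lemma y_others: "i < n \<Longrightarrow> y i k \<in> borel_measurable (others j k)"
  unfolding y_def[abs_def] by (intro borel_measurable_diff borel_measurable_const ghat_others)

lemma delta_others: "i < n \<Longrightarrow> \<delta> i k \<in> borel_measurable (others j k)"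
  by (rule measurable_from_subalg[OF subalgebra_others_join delta_join])

lemma q_others: "i < n \<Longrightarrow> i \<noteq> j \<Longrightarrow> q i k \<in> borel_measurable (others j k)"
  unfolding q_def[abs_def] by (intro borel_measurable_diff g_others y_others)

lemma centered_delta: "i < n \<Longrightarrow> centered M (F k) (\<delta> i k)"
  unfolding \<delta>_def[abs_def] by (rule has_cond_exp_centered_diff[OF ghat_cond_exp subalgebra_F])

lemma square_integrable_delta:
  assumes i: "i < n"
  shows "square_integrable M (\<delta> i k)"
  unfolding square_integrable_def
proof
  show "\<delta> i k \<in> borel_measurable M"
    by (rule measurable_from_subalg[OF subalgebra_join_smp delta_join]) (rule i)+
  show "integrable M (\<lambda>w. (norm (\<delta> i k w))\<^sup>2)"
    using ghat_cond_var[OF i, of k] unfolding cond_exp_le_def \<delta>_def by simp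
qed

text \<open>
  The following facts about step \<open>k\<close> take square integrability of \<open>x k\<close> as a hypothesis, because they
  serve in the induction that proves it: the sampling errors have bounded variance, and the
  remaining terms grow at most linearly in the iterate.
\<close>

lemma square_integrable_alpha_of_x:
  assumes i: "i < n" and x: "square_integrable M (x k)"
  shows "square_integrable M (\<alpha> i k)"
proof (rule square_integrable_bound)
  show "square_integrable M (\<lambda>w. x k w - xs)"
    by (intro square_integrable_diff x square_integrable_const)
  show "\<alpha> i k \<in> borel_measurable M"
    by (rule measurable_from_subalg[OF subalgebra_F alpha_F[OF i]])
  show "norm (\<alpha> i k w) \<le> L * norm (x k w - xs)" for w
    unfolding \<alpha>_def by (rule L_smooth_grad_le[OF smooth[OF i]])
qed

lemma square_integrable_y_of_x:
  assumes "i < n" and "square_integrable M (x k)"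
  shows "square_integrable M (y i k)"
  unfolding y_eq[abs_def]
  by (intro square_integrable_add square_integrable_delta square_integrable_alpha_of_x assms)

lemma q_of_x:
  assumes i: "i < n" and x: "square_integrable M (x k)"
  shows square_integrable_q_of_x: "square_integrable M (q i k)"
    and centered_q_of_x: "centered M (others i k) (q i k)"
    and q_le_of_x: "\<And>A. A \<in> sets (others i k) \<Longrightarrow>
      (LINT w:A|M. (norm (q i k w))\<^sup>2) \<le> \<omega> * (LINT w:A|M. (norm (y i k w))\<^sup>2)"
proof -
  have "q i k = (\<lambda>w. Q (y i k w) (seed i k w) - y i k w)"
    unfolding q_def[abs_def] g_eq[OF i] y_def ..
  note * = this quantization_error[OF subalgebra_others seed_measurable[OF i] seed_distr[OF i]
      seed_indep_others[OF i] Q omega_pos y_others[OF i] square_integrable_y_of_x[OF i x]]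
  show "square_integrable M (q i k)" "centered M (others i k) (q i k)"
    "\<And>A. A \<in> sets (others i k) \<Longrightarrow>
      (LINT w:A|M. (norm (q i k w))\<^sup>2) \<le> \<omega> * (LINT w:A|M. (norm (y i k w))\<^sup>2)"
    unfolding *(1) using *(2-4) by blast+
qed

lemma square_integrable_x: "square_integrable M (x k)"
proof (induction k rule: less_induct)
  case (less k)
  have g: "square_integrable M (g i t)" if "t < k" "i < n" for i t
  proof -
    have "g i t = (\<lambda>w. q i t w + y i t w)"
      unfolding q_def by simp
    then show ?thesis
      using square_integrable_add[OF square_integrable_q_of_x square_integrable_y_of_x] less.IH that
      by metis
  qed
  then have "square_integrable M (gm t)" if "t < k" for t
    using that unfolding gm_def[abs_def] by (intro square_integrable_scaleR square_integrable_sum) auto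
  then show ?case
    unfolding x_eq[of k, abs_def]
    by (intro square_integrable_diff square_integrable_const square_integrable_scaleR square_integrable_sum) auto
qed

lemmas square_integrable_alpha = square_integrable_alpha_of_x[OF _ square_integrable_x]
lemmas square_integrable_q = square_integrable_q_of_x[OF _ square_integrable_x]
lemmas centered_q = centered_q_of_x[OF _ square_integrable_x]
lemmas q_le = q_le_of_x[OF _ square_integrable_x]

lemma square_integrable_noise: "square_integrable M (noise k)"
  unfolding noise_eq[abs_def]
  by (intro square_integrable_scaleR square_integrable_sum square_integrable_add
      square_integrable_delta square_integrable_q) auto

lemma centered_noise: "centered M (F k) (noise k)"
  unfolding noise_eq[abs_def]
  by (intro centered_scaleR centered_sum centered_add centered_delta
      centered_mono[OF centered_q sets_F_others] subalgebra_F) auto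

lemma square_integrable_grad_h: "square_integrable M (\<lambda>w. grad h (x k w))"
proof (rule square_integrable_bound)
  show "square_integrable M (\<lambda>w. x k w - xs)"
    by (intro square_integrable_diff square_integrable_x square_integrable_const)
  show "(\<lambda>w. grad h (x k w)) \<in> borel_measurable M"
    by (rule measurable_from_subalg[OF subalgebra_F grad_h_F])
  show "norm (grad h (x k w)) \<le> L * norm (x k w - xs)" for w
    by (rule grad_h_Lipschitz_minimum)
qed

lemma gm_eq: "gm k w = grad h (x k w) + noise k w"
  unfolding noise_def by simp

lemma square_integrable_gm: "square_integrable M (gm k)"
  unfolding gm_eq[abs_def] by (intro square_integrable_add square_integrable_grad_h square_integrable_noise)

lemma gap_nonneg: "0 \<le> gap k w"
  unfolding gap_def using minimum by simp

lemma gap_F: "gap k \<in> borel_measurable (F k)"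
  unfolding gap_def[abs_def]
  by (intro borel_measurable_diff borel_measurable_const measurable_compose[OF x_F h_measurable])

lemma integrable_gap:
  assumes "\<mu> \<ge> 0"
  shows "integrable M (gap k)"
proof (rule Bochner_Integration.integrable_bound)
  have "square_integrable M (\<lambda>w. x k w - xs)"
    by (intro square_integrable_diff square_integrable_x square_integrable_const)
  then show "integrable M (\<lambda>w. L * (norm (x k w - xs))\<^sup>2)"
    using square_integrable_norm by auto
  show "gap k \<in> borel_measurable M"
    by (rule measurable_from_subalg[OF subalgebra_F gap_F])
  have "gap k w \<le> L * (norm (x k w - xs))\<^sup>2" for w
  proof -
    have "0 \<le> \<mu> / 2 * (norm (x k w - xs))\<^sup>2"
      using assms by simp
    then show ?thesis
      using gap_le[of "x k w"] unfolding gap_def by linarith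
  qed
  then show "AE w in M. norm (gap k w) \<le> norm (L * (norm (x k w - xs))\<^sup>2)"
    using gap_nonneg L_pos by (simp add: abs_mult)
qed

text \<open>
  Two sampling errors are orthogonal by conditional independence; in every other product there is
  a quantization error whose seed is independent of the other factor.
\<close>

lemma errors_orthogonal:
  assumes i: "i < n" and j: "j < n" and ij: "i \<noteq> j" and A: "A \<in> sets (F k)"
  shows "(LINT w:A|M. (\<delta> i k w + q i k w) \<bullet> (\<delta> j k w + q j k w)) = 0"
proof -
  have AM: "A \<in> sets M"
    by (rule sets_F[OF A])
  have A_others: "A \<in> sets (others l k)" for l
    using A sets_F_others by blast
  have A_join: "A \<in> sets (join M (F k) (vimage_algebra (space M) (smp i k) N))"
    using A subalgebra_join_F[OF i, of k] unfolding subalgebra_def by blast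
  have 1: "(LINT w:A|M. \<delta> j k w \<bullet> \<delta> i k w) = 0"
  proof (rule set_integral_orthogonal[OF _ subalgebra_join_smp[OF i] _ delta_join[OF i]])
    show "centered M (join M (F k) (vimage_algebra (space M) (smp i k) N)) (\<delta> j k)"
      using cond_indep_samples[of k] i j ij delta_join[OF j, of k] centered_delta[OF j, of k]
      by (intro cond_indep_centered[OF subalgebra_F, where j = j]) auto
  qed (use A_join square_integrable_delta i j in auto)
  have 2: "(LINT w:A|M. q j k w \<bullet> \<delta> i k w) = 0"
    by (rule set_integral_orthogonal[OF centered_q[OF j] subalgebra_others square_integrable_q[OF j]
          delta_others[OF i] square_integrable_delta[OF i] A_others])
  have 3: "(LINT w:A|M. q i k w \<bullet> (\<delta> j k w + q j k w)) = 0"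
    using ij i j by (intro set_integral_orthogonal[OF centered_q[OF i] subalgebra_others square_integrable_q[OF i]]
          borel_measurable_add square_integrable_add delta_others q_others square_integrable_delta
          square_integrable_q A_others) auto
  have int: "set_integrable M A (\<lambda>w. X w \<bullet> Z w)"
    if "square_integrable M X" "square_integrable M Z" for X Z :: "'w \<Rightarrow> 'a"
    using integrable_inner[OF that] AM integrable_mult_indicator unfolding set_integrable_def by blast
  have "(\<delta> i k w + q i k w) \<bullet> (\<delta> j k w + q j k w)
      = (\<delta> j k w \<bullet> \<delta> i k w + q j k w \<bullet> \<delta> i k w) + q i k w \<bullet> (\<delta> j k w + q j k w)" for w
    by (simp add: inner_add_left inner_add_right inner_commute)
  then have "(LINT w:A|M. (\<delta> i k w + q i k w) \<bullet> (\<delta> j k w + q j k w))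
      = (LINT w:A|M. (\<delta> j k w \<bullet> \<delta> i k w + q j k w \<bullet> \<delta> i k w) + q i k w \<bullet> (\<delta> j k w + q j k w))"
    by simp
  also have "\<dots> = (LINT w:A|M. \<delta> j k w \<bullet> \<delta> i k w + q j k w \<bullet> \<delta> i k w)
      + (LINT w:A|M. q i k w \<bullet> (\<delta> j k w + q j k w))"
    using i j by (intro set_integral_add(2) set_integral_add(1) int square_integrable_add
        square_integrable_delta square_integrable_q)
  also have "(LINT w:A|M. \<delta> j k w \<bullet> \<delta> i k w + q j k w \<bullet> \<delta> i k w)
      = (LINT w:A|M. \<delta> j k w \<bullet> \<delta> i k w) + (LINT w:A|M. q j k w \<bullet> \<delta> i k w)"
    using i j by (intro set_integral_add(2) int square_integrable_delta square_integrable_q)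
  finally show ?thesis
    using 1 2 3 by simp
qed

lemma error_second_moment:
  assumes i: "i < n" and A: "A \<in> sets (F k)"
  shows "(LINT w:A|M. (norm (\<delta> i k w + q i k w))\<^sup>2)
    \<le> (\<omega> + 1) * (LINT w:A|M. Dw i) + \<omega> * (LINT w:A|M. (norm (\<alpha> i k w))\<^sup>2)"
proof -
  have AM: "A \<in> sets M" and A_others: "A \<in> sets (others i k)"
    using sets_F[OF A] A sets_F_others by auto
  have "(LINT w:A|M. q i k w \<bullet> \<delta> i k w) = 0"
    by (rule set_integral_orthogonal[OF centered_q[OF i] subalgebra_others square_integrable_q[OF i]
          delta_others[OF i] square_integrable_delta[OF i] A_others])
  then have "(LINT w:A|M. (norm (\<delta> i k w + q i k w))\<^sup>2)
      = (LINT w:A|M. (norm (\<delta> i k w))\<^sup>2) + (LINT w:A|M. (norm (q i k w))\<^sup>2)"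
    by (intro set_integral_norm_add_orthogonal square_integrable_delta square_integrable_q i AM)
       (simp add: inner_commute)
  also have "\<dots> \<le> (LINT w:A|M. (norm (\<delta> i k w))\<^sup>2) + \<omega> * (LINT w:A|M. (norm (y i k w))\<^sup>2)"
    using q_le[OF i A_others] by simp
  also have "(LINT w:A|M. (norm (y i k w))\<^sup>2)
      = (LINT w:A|M. (norm (\<delta> i k w))\<^sup>2) + (LINT w:A|M. (norm (\<alpha> i k w))\<^sup>2)"
    unfolding y_eq
    by (intro set_integral_norm_add_orthogonal square_integrable_delta square_integrable_alpha i AM
        set_integral_orthogonal[OF centered_delta[OF i] subalgebra_F] alpha_F A)
  finally have "(LINT w:A|M. (norm (\<delta> i k w + q i k w))\<^sup>2)
      \<le> (\<omega> + 1) * (LINT w:A|M. (norm (\<delta> i k w))\<^sup>2) + \<omega> * (LINT w:A|M. (norm (\<alpha> i k w))\<^sup>2)"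
    by (simp add: algebra_simps)
  moreover have "(LINT w:A|M. (norm (\<delta> i k w))\<^sup>2) \<le> (LINT w:A|M. Dw i)"
    using cond_exp_leD[OF subalgebra_F ghat_cond_var[OF i] _ A] unfolding \<delta>_def by simp
  then have "(\<omega> + 1) * (LINT w:A|M. (norm (\<delta> i k w))\<^sup>2) \<le> (\<omega> + 1) * (LINT w:A|M. Dw i)"
    using omega_pos by (intro mult_left_mono) auto
  ultimately show ?thesis by linarith
qed

text \<open>
  Averaging over \<open>n\<close> workers with orthogonal errors divides the variance by \<open>n\<close>, and
  \<open>sum_grad_diff_le\<close> bounds the part of it that the quantization contributes by the gap.
\<close>

lemma noise_second_moment:
  assumes A: "A \<in> sets (F k)" and "\<mu> \<ge> 0"
  shows "(LINT w:A|M. (norm (noise k w))\<^sup>2) \<le> (LINT w:A|M. 2 * L * (\<omega> / real n) * gap k w + D1)"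
proof -
  have AM: "A \<in> sets M"
    by (rule sets_F[OF A])
  have int: "set_integrable M A V" if "integrable M V" for V :: "'w \<Rightarrow> real"
    using that AM integrable_mult_indicator unfolding set_integrable_def by blast
  have int_alpha: "integrable M (\<lambda>w. (norm (\<alpha> i k w))\<^sup>2)" if "i < n" for i
    using square_integrable_alpha[OF that] by (rule square_integrable_norm)
  have "(LINT w:A|M. (norm (noise k w))\<^sup>2)
      = (LINT w:A|M. (1 / real n)\<^sup>2 * (norm (\<Sum>i<n. \<delta> i k w + q i k w))\<^sup>2)"
    unfolding noise_eq by (simp add: power_divide)
  also have "\<dots> = (1 / real n)\<^sup>2 * (LINT w:A|M. (norm (\<Sum>i<n. \<delta> i k w + q i k w))\<^sup>2)"
    by (rule set_integral_mult_right)
  also have "(LINT w:A|M. (norm (\<Sum>i<n. \<delta> i k w + q i k w))\<^sup>2)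
      = (\<Sum>i<n. LINT w:A|M. (norm (\<delta> i k w + q i k w))\<^sup>2)"
    by (intro set_integral_norm_sum_orthogonal square_integrable_add square_integrable_delta
        square_integrable_q AM errors_orthogonal A) auto
  also have "(1 / real n)\<^sup>2 * \<dots> \<le> (1 / real n)\<^sup>2 * (\<Sum>i<n. (\<omega> + 1) * (LINT w:A|M. Dw i) + \<omega> * (LINT w:A|M. (norm (\<alpha> i k w))\<^sup>2))"
    using A by (intro mult_left_mono sum_mono error_second_moment) auto
  also have "\<dots> = (1 / real n)\<^sup>2 * ((\<omega> + 1) * (\<Sum>i<n. LINT w:A|M. Dw i) + \<omega> * (\<Sum>i<n. LINT w:A|M. (norm (\<alpha> i k w))\<^sup>2))"
    by (simp add: sum.distrib sum_distrib_left)
  also have "(\<Sum>i<n. LINT w:A|M. (norm (\<alpha> i k w))\<^sup>2) = (LINT w:A|M. (\<Sum>i<n. (norm (\<alpha> i k w))\<^sup>2))"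
    unfolding set_lebesgue_integral_def scaleR_sum_right using int[OF int_alpha]
    by (intro Bochner_Integration.integral_sum[symmetric]) (auto simp: set_integrable_def)
  also have "(1 / real n)\<^sup>2 * ((\<omega> + 1) * (\<Sum>i<n. LINT w:A|M. Dw i) + \<omega> * (LINT w:A|M. (\<Sum>i<n. (norm (\<alpha> i k w))\<^sup>2)))
     \<le> (1 / real n)\<^sup>2 * ((\<omega> + 1) * (\<Sum>i<n. LINT w:A|M. Dw i) + \<omega> * (LINT w:A|M. real n * (2 * L * gap k w)))"
  proof (intro mult_left_mono add_left_mono set_integral_mono)
    show "set_integrable M A (\<lambda>w. \<Sum>i<n. (norm (\<alpha> i k w))\<^sup>2)"
      using int_alpha by (intro int Bochner_Integration.integrable_sum) auto
    show "set_integrable M A (\<lambda>w. real n * (2 * L * gap k w))"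
      using integrable_gap[OF \<open>\<mu> \<ge> 0\<close>] by (intro int) auto
    show "(\<Sum>i<n. (norm (\<alpha> i k w))\<^sup>2) \<le> real n * (2 * L * gap k w)" for w
      unfolding \<alpha>_def gap_def by (rule sum_grad_diff_le)
  qed (use omega_pos in auto)
  also have "\<dots> = 2 * L * (\<omega> / real n) * (LINT w:A|M. gap k w) + measure M A * D1"
  proof -
    have "(LINT w:A|M. Dw i) = measure M A * Dw i" for i
      using AM by (simp add: set_integral_const emeasure_finite)
    then have "(\<Sum>i<n. LINT w:A|M. Dw i) = measure M A * (\<Sum>i<n. Dw i)"
      by (simp add: sum_distrib_left)
    moreover have "(LINT w:A|M. real n * (2 * L * gap k w)) = real n * (2 * L) * (LINT w:A|M. gap k w)"
      by (simp add: mult.assoc[symmetric])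
    ultimately show ?thesis
      using n_pos unfolding D1_def by (simp add: field_simps power2_eq_square)
  qed
  also have "\<dots> = (LINT w:A|M. 2 * L * (\<omega> / real n) * gap k w + D1)"
    using int[OF integrable_gap[OF \<open>\<mu> \<ge> 0\<close>]] AM
    by (subst set_integral_add(2)) (auto simp: set_integral_const emeasure_finite intro!: int)
  finally show ?thesis .
qed

lemma has_cond_exp_gm: "has_cond_exp M (F k) (gm k) (\<lambda>w. grad h (x k w))"
  unfolding has_cond_exp_def
proof (intro conjI ballI)
  have sq: "integrable M (gm k)" "integrable M (\<lambda>w. grad h (x k w))" "integrable M (noise k)"
    using square_integrable_gm square_integrable_grad_h square_integrable_noise
    by (auto intro: square_integrable_integrable)
  show "integrable M (gm k)" "integrable M (\<lambda>w. grad h (x k w))"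
    by (fact sq)+
  show "(\<lambda>w. grad h (x k w)) \<in> borel_measurable (F k)"
    by (rule grad_h_F)
  fix A assume A: "A \<in> sets (F k)"
  have "(LINT w:A|M. gm k w) = (LINT w:A|M. grad h (x k w)) + (LINT w:A|M. noise k w)"
    unfolding gm_eq using sq sets_F[OF A]
    by (intro set_integral_add(2)) (auto simp: set_integrable_def intro: integrable_mult_indicator)
  then show "(LINT w:A|M. gm k w) = (LINT w:A|M. grad h (x k w))"
    using centered_noise[of k] A unfolding centered_def by simp
qed

lemma gm_second_moment:
  assumes A: "A \<in> sets (F k)" and "\<mu> \<ge> 0"
  shows "(LINT w:A|M. (norm (gm k w))\<^sup>2) \<le> (LINT w:A|M. 2 * (L * (1 + \<omega> / real n)) * gap k w + D1)"
proof -
  have AM: "A \<in> sets M"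
    by (rule sets_F[OF A])
  have int: "set_integrable M A V" if "integrable M V" for V :: "'w \<Rightarrow> real"
    using that AM integrable_mult_indicator unfolding set_integrable_def by blast
  have intg: "integrable M (gap k)"
    by (rule integrable_gap[OF \<open>\<mu> \<ge> 0\<close>])
  have "(LINT w:A|M. noise k w \<bullet> grad h (x k w)) = 0"
    by (rule set_integral_orthogonal[OF centered_noise subalgebra_F square_integrable_noise grad_h_F
          square_integrable_grad_h A])
  then have "(LINT w:A|M. (norm (gm k w))\<^sup>2)
      = (LINT w:A|M. (norm (grad h (x k w)))\<^sup>2) + (LINT w:A|M. (norm (noise k w))\<^sup>2)"
    unfolding gm_eq
    by (intro set_integral_norm_add_orthogonal square_integrable_grad_h square_integrable_noise AM)
       (simp add: inner_commute)
  also have "\<dots> \<le> (LINT w:A|M. 2 * L * gap k w) + (LINT w:A|M. 2 * L * (\<omega> / real n) * gap k w + D1)"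
  proof (intro add_mono noise_second_moment assms set_integral_mono)
    show "set_integrable M A (\<lambda>w. (norm (grad h (x k w)))\<^sup>2)"
      by (intro int square_integrable_norm square_integrable_grad_h)
    show "set_integrable M A (\<lambda>w. 2 * L * gap k w)"
      using intg by (intro int) simp
    show "(norm (grad h (x k w)))\<^sup>2 \<le> 2 * L * gap k w" for w
      unfolding gap_def by (rule grad_h_le)
  qed
  also have "\<dots> = (LINT w:A|M. 2 * L * gap k w + (2 * L * (\<omega> / real n) * gap k w + D1))"
    using intg by (intro set_integral_add(2)[symmetric] int) auto
  also have "\<dots> = (LINT w:A|M. 2 * (L * (1 + \<omega> / real n)) * gap k w + D1)"
    by (simp add: algebra_simps)
  finally show ?thesis .
qed

end

section \<open>Geometric weights\<close>

lemma wgt_pos: "\<eta> < 1 \<Longrightarrow> 0 < wgt \<eta> k"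
  unfolding wgt_def by simp

lemma Wgt_pos: "\<eta> < 1 \<Longrightarrow> 0 < Wgt \<eta> K"
  unfolding Wgt_def by (intro sum_pos wgt_pos) auto

lemma wgt_shift:
  assumes "\<eta> < 1" "t \<le> k"
  shows "wgt \<eta> t = (1 - \<eta>) ^ (k - t) * wgt \<eta> k"
proof -
  have "(1 - \<eta>) ^ (k + 1) = (1 - \<eta>) ^ (k - t) * (1 - \<eta>) ^ (t + 1)"
    using assms(2) by (simp add: power_add[symmetric])
  then show ?thesis
    using assms(1) unfolding wgt_def by simp
qed

text \<open>
  Over a window of length \<open>\<tau>\<close> the weights grow at most by a factor \<open>2\<close>, by Bernoulli's
  inequality, and every index lies in at most \<open>\<tau>\<close> windows.
\<close>

lemma weighted_window_sum_le:
  fixes r :: "nat \<Rightarrow> real"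
  assumes \<eta>: "0 \<le> \<eta>" "\<eta> < 1" "real \<tau> * \<eta> \<le> 1 / 2" and r: "\<And>t. 0 \<le> r t"
  shows "(\<Sum>k\<le>K. wgt \<eta> k * (\<Sum>t\<in>{k - \<tau>..<k}. r t)) \<le> 2 * real \<tau> * (\<Sum>t\<le>K. wgt \<eta> t * r t)"
proof -
  have w: "wgt \<eta> k \<le> 2 * wgt \<eta> t" if "t \<in> {k - \<tau>..<k}" for k t
  proof -
    have "1 / 2 \<le> 1 + real \<tau> * (- \<eta>)"
      using \<eta>(3) by simp
    also have "\<dots> \<le> (1 + (- \<eta>)) ^ \<tau>"
      using \<eta> by (intro Bernoulli_inequality) simp
    also have "\<dots> = (1 - \<eta>) ^ \<tau>"
      by simp
    also have "\<dots> \<le> (1 - \<eta>) ^ (k - t)"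
    proof (rule power_decreasing)
      show "k - t \<le> \<tau>" using that by auto
    qed (use \<eta> in auto)
    finally have "1 / 2 * wgt \<eta> k \<le> (1 - \<eta>) ^ (k - t) * wgt \<eta> k"
      using wgt_pos[OF \<eta>(2), of k] by (intro mult_right_mono) auto
    then show ?thesis
      using wgt_shift[OF \<eta>(2), of t k] that by simp
  qed
  have "(\<Sum>k\<le>K. wgt \<eta> k * (\<Sum>t\<in>{k - \<tau>..<k}. r t)) = (\<Sum>k\<le>K. \<Sum>t\<in>{k - \<tau>..<k}. wgt \<eta> k * r t)"
    by (simp add: sum_distrib_left)
  also have "\<dots> \<le> (\<Sum>k\<le>K. \<Sum>t\<in>{k - \<tau>..<k}. 2 * wgt \<eta> t * r t)"
    using w r by (intro sum_mono mult_right_mono) auto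
  also have "\<dots> = (\<Sum>k\<le>K. \<Sum>t\<in>{t \<in> {..K}. k - \<tau> \<le> t \<and> t < k}. 2 * wgt \<eta> t * r t)"
    by (intro sum.cong) auto
  also have "\<dots> = (\<Sum>t\<le>K. \<Sum>k\<in>{k \<in> {..K}. k - \<tau> \<le> t \<and> t < k}. 2 * wgt \<eta> t * r t)"
    by (rule sum.swap_restrict) auto
  also have "\<dots> \<le> (\<Sum>t\<le>K. real \<tau> * (2 * wgt \<eta> t * r t))"
  proof (rule sum_mono)
    fix t assume "t \<in> {..K}"
    have "card {k \<in> {..K}. k - \<tau> \<le> t \<and> t < k} \<le> card {t + 1..t + \<tau>}"
      by (rule card_mono) auto
    then have "real (card {k \<in> {..K}. k - \<tau> \<le> t \<and> t < k}) \<le> real \<tau>"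
      by simp
    then show "(\<Sum>k\<in>{k \<in> {..K}. k - \<tau> \<le> t \<and> t < k}. 2 * wgt \<eta> t * r t) \<le> real \<tau> * (2 * wgt \<eta> t * r t)"
      using wgt_pos[OF \<eta>(2), of t] r[of t] by (simp add: mult_right_mono)
  qed
  also have "\<dots> = 2 * real \<tau> * (\<Sum>t\<le>K. wgt \<eta> t * r t)"
    by (simp add: sum_distrib_left mult.assoc mult.left_commute)
  finally show ?thesis .
qed

text \<open>The weights make a contraction by \<open>1 - \<eta>\<close> telescope.\<close>

lemma weighted_contraction_sum_le:
  fixes T r :: "nat \<Rightarrow> real"
  assumes \<eta>: "\<eta> < 1" and T: "\<And>k. 0 \<le> T k"
    and step: "\<And>k. r k \<le> (1 - \<eta>) * T k - T (Suc k)"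
  shows "(\<Sum>k\<le>K. wgt \<eta> k * r k) \<le> T 0"
proof -
  have "(\<Sum>k\<le>K. wgt \<eta> k * r k) \<le> T 0 - wgt \<eta> K * T (Suc K)"
  proof (induction K)
    case 0
    have "wgt \<eta> 0 * r 0 \<le> wgt \<eta> 0 * ((1 - \<eta>) * T 0 - T (Suc 0))"
      using step[of 0] wgt_pos[OF \<eta>, of 0] by (intro mult_left_mono) auto
    moreover have "wgt \<eta> 0 * (1 - \<eta>) = 1"
      using \<eta> unfolding wgt_def by simp
    ultimately show ?case
      by (simp add: right_diff_distrib mult.assoc[symmetric])
  next
    case (Suc K)
    have "wgt \<eta> (Suc K) * r (Suc K) \<le> wgt \<eta> (Suc K) * ((1 - \<eta>) * T (Suc K) - T (Suc (Suc K)))"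
      using step[of "Suc K"] wgt_pos[OF \<eta>, of "Suc K"] by (intro mult_left_mono) auto
    moreover have "wgt \<eta> (Suc K) * (1 - \<eta>) = wgt \<eta> K"
      using wgt_shift[OF \<eta>, of K "Suc K"] by (simp add: mult.commute)
    ultimately have "wgt \<eta> (Suc K) * r (Suc K) \<le> wgt \<eta> K * T (Suc K) - wgt \<eta> (Suc K) * T (Suc (Suc K))"
      by (simp add: right_diff_distrib mult.assoc[symmetric])
    then show ?case
      using Suc by simp
  qed
  then show ?thesis
    using mult_nonneg_nonneg[OF less_imp_le[OF wgt_pos[OF \<eta>]] T, of K "Suc K"] by linarith
qed

section \<open>Error feedback and convergence\<close>

context dqsgd
begin

lemma noise_F: "s < t \<Longrightarrow> noise s \<in> borel_measurable (F t)"
  unfolding noise_def[abs_def]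
  by (intro borel_measurable_diff gm_F measurable_compose[OF _ grad_h_measurable]
      measurable_from_subalg[OF subalgebra_F_F x_F]) auto

lemma square_integrable_em: "square_integrable M (em k)"
  unfolding em_eq[abs_def] by (intro square_integrable_scaleR square_integrable_sum square_integrable_gm)

lemma expected_noise_le:
  assumes "\<mu> \<ge> 0"
  shows "(LINT w|M. (norm (noise t w))\<^sup>2) \<le> 2 * L * (\<omega> / real n) * (LINT w|M. gap t w) + D1"
proof -
  have "space M \<in> sets (F t)"
    using sets.top[of "F t"] by (simp add: space_F)
  from noise_second_moment[OF this assms] show ?thesis
    using square_integrable_norm[OF square_integrable_noise, of t] integrable_gap[OF assms, of t]
    by (simp add: set_integral_space prob_space)
qed

lemma expected_gm_le:
  assumes "\<mu> \<ge> 0"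
  shows "(LINT w|M. (norm (gm t w))\<^sup>2) \<le> 2 * (L * (1 + \<omega> / real n)) * (LINT w|M. gap t w) + D1"
proof -
  have "space M \<in> sets (F t)"
    using sets.top[of "F t"] by (simp add: space_F)
  from gm_second_moment[OF this assms] show ?thesis
    using square_integrable_norm[OF square_integrable_gm, of t] integrable_gap[OF assms, of t]
    by (simp add: set_integral_space prob_space)
qed

text \<open>
  The error is \<open>\<gamma>\<close> times the sum of the stochastic vectors that are still under way. The points at
  which these were computed depend only on vectors from before the window. So the gradients in
  the window are orthogonal to all the noises in it, and the noises, orthogonal to each other,
  contribute the sum of their variances with constant \<open>1\<close>. The usual splitting of the square by Young's inequality would lose
  a factor here.
\<close>

lemma em_second_moment:
  assumes "\<mu> \<ge> 0"
  shows "(LINT w|M. (norm (em k w))\<^sup>2)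
    \<le> \<gamma>\<^sup>2 * (\<Sum>t\<in>{k - \<tau>..<k}. 2 * L * (real \<tau> + \<omega> / real n) * (LINT w|M. gap t w) + D1)"
proof -
  define I where "I = {k - \<tau>..<k}"
  have cardI: "real (card I) \<le> real \<tau>"
    unfolding I_def by simp
  define G where "G w = (\<Sum>t\<in>I. grad h (x t w))" for w
  have sqG: "square_integrable M G"
    unfolding G_def[abs_def] by (intro square_integrable_sum square_integrable_grad_h)
  have sqN: "square_integrable M (\<lambda>w. \<Sum>t\<in>I. noise t w)"
    by (intro square_integrable_sum square_integrable_noise)
  have cross: "(LINT w|M. noise s w \<bullet> G w) = 0" if s: "s \<in> I" for s
  proof (rule centered_orthogonal[OF centered_noise subalgebra_F square_integrable_noise _ sqG])
    have "(\<lambda>w. grad h (x t w)) \<in> borel_measurable (F s)" if "t \<in> I" for t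
      using s that unfolding I_def
      by (intro measurable_compose[OF x_F_delayed grad_h_measurable]) auto
    then show "G \<in> borel_measurable (F s)"
      unfolding G_def[abs_def] by (intro borel_measurable_sum) auto
  qed
  have noises: "(LINT w|M. noise s w \<bullet> noise t w) = 0" if "s \<noteq> t" for s t
  proof -
    have later: "(LINT w|M. noise b w \<bullet> noise a w) = 0" if "a < b" for a b
      by (rule centered_orthogonal[OF centered_noise subalgebra_F square_integrable_noise
            noise_F[OF that] square_integrable_noise])
    show ?thesis
      using later[of s t] later[of t s] that by (cases "s < t") (auto simp: inner_commute)
  qed
  have "(LINT w|M. G w \<bullet> (\<Sum>t\<in>I. noise t w)) = (\<Sum>t\<in>I. LINT w|M. noise t w \<bullet> G w)"
    unfolding inner_sum_right by (subst Bochner_Integration.integral_sum)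
      (auto simp: inner_commute intro!: integrable_inner sqG square_integrable_noise)
  also have "\<dots> = 0"
    using cross by simp
  finally have orth: "(LINT w|M. G w \<bullet> (\<Sum>t\<in>I. noise t w)) = 0" .
  have "(LINT w|M. (norm (em k w))\<^sup>2) = \<gamma>\<^sup>2 * (LINT w|M. (norm (G w + (\<Sum>t\<in>I. noise t w)))\<^sup>2)"
    unfolding em_eq gm_eq G_def I_def by (simp add: sum.distrib power_mult_distrib)
  also have "(LINT w|M. (norm (G w + (\<Sum>t\<in>I. noise t w)))\<^sup>2)
      = (LINT w|M. (norm (G w))\<^sup>2) + (LINT w|M. (norm (\<Sum>t\<in>I. noise t w))\<^sup>2)"
    using integral_norm_add_power2[OF sqG sqN] orth by simp
  also have "(LINT w|M. (norm (\<Sum>t\<in>I. noise t w))\<^sup>2) = (\<Sum>t\<in>I. LINT w|M. (norm (noise t w))\<^sup>2)"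
    by (intro integral_norm_sum_orthogonal square_integrable_noise noises) (auto simp: I_def)
  also have "\<gamma>\<^sup>2 * ((LINT w|M. (norm (G w))\<^sup>2) + (\<Sum>t\<in>I. LINT w|M. (norm (noise t w))\<^sup>2))
      \<le> \<gamma>\<^sup>2 * (real \<tau> * (\<Sum>t\<in>I. 2 * L * (LINT w|M. gap t w))
          + (\<Sum>t\<in>I. 2 * L * (\<omega> / real n) * (LINT w|M. gap t w) + D1))"
  proof (intro mult_left_mono add_mono sum_mono expected_noise_le assms)
    have "(LINT w|M. (norm (G w))\<^sup>2) \<le> (LINT w|M. real \<tau> * (\<Sum>t\<in>I. 2 * L * gap t w))"
    proof (rule integral_mono)
      show "integrable M (\<lambda>w. (norm (G w))\<^sup>2)"
        by (rule square_integrable_norm[OF sqG])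
      show "integrable M (\<lambda>w. real \<tau> * (\<Sum>t\<in>I. 2 * L * gap t w))"
        using integrable_gap[OF assms] by simp
      fix w
      have "(norm (G w))\<^sup>2 \<le> real (card I) * (\<Sum>t\<in>I. (norm (grad h (x t w)))\<^sup>2)"
        unfolding G_def by (rule norm_sum_power2_le) (simp add: I_def)
      also have "\<dots> \<le> real \<tau> * (\<Sum>t\<in>I. 2 * L * gap t w)"
        using cardI unfolding gap_def
        by (intro mult_mono sum_mono grad_h_le sum_nonneg) auto
      finally show "(norm (G w))\<^sup>2 \<le> real \<tau> * (\<Sum>t\<in>I. 2 * L * gap t w)" .
    qed
    also have "\<dots> = real \<tau> * (\<Sum>t\<in>I. 2 * L * (LINT w|M. gap t w))"
      using integrable_gap[OF assms] by (simp add: Bochner_Integration.integral_sum)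
    finally show "(LINT w|M. (norm (G w))\<^sup>2) \<le> real \<tau> * (\<Sum>t\<in>I. 2 * L * (LINT w|M. gap t w))" .
  qed simp
  also have "\<dots> = \<gamma>\<^sup>2 * (\<Sum>t\<in>I. 2 * L * (real \<tau> + \<omega> / real n) * (LINT w|M. gap t w) + D1)"
    unfolding sum_distrib_left[of "real \<tau>"] sum.distrib[symmetric]
    by (simp add: algebra_simps)
  finally show ?thesis
    unfolding I_def .
qed

end

locale dqsgd_stepsize = dqsgd +
  assumes mu_nonneg: "\<mu> \<ge> 0" and Dw_nonneg: "\<And>i. i < n \<Longrightarrow> Dw i \<ge> 0" and gamma_pos: "\<gamma> > 0"
    and step_smooth: "\<gamma> * (4 * L * (1 + \<omega> / real n)) \<le> 1"
    and step_delay: "(\<gamma> * L)\<^sup>2 * (64 * (real \<tau> * (real \<tau> + 1 + \<omega> / real n))) \<le> 1"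
begin

definition \<eta> :: real where "\<eta> = \<gamma> * \<mu> / 2"

lemma D1_nonneg: "0 \<le> D1"
  unfolding D1_def using omega_pos Dw_nonneg by (auto intro!: divide_nonneg_nonneg mult_nonneg_nonneg sum_nonneg)

lemma omega_n: "0 \<le> \<omega> / real n"
  using omega_pos by simp

lemma gamma_L_tau: "\<gamma> * L * real \<tau> \<le> 1 / 8"
proof -
  have "(\<gamma> * L)\<^sup>2 * (64 * (real \<tau> * real \<tau>)) \<le> (\<gamma> * L)\<^sup>2 * (64 * (real \<tau> * (real \<tau> + 1 + \<omega> / real n)))"
    using omega_n by (intro mult_left_mono) auto
  also have "\<dots> \<le> 1" by (rule step_delay)
  finally have "(8 * (\<gamma> * L * real \<tau>))\<^sup>2 \<le> 1\<^sup>2"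
    by (simp add: power2_eq_square algebra_simps)
  then have "8 * (\<gamma> * L * real \<tau>) \<le> 1"
    by (rule power2_le_imp_le) simp
  then show ?thesis by simp
qed

lemma eta_bounds: "0 \<le> \<eta>" "\<eta> \<le> 1 / 8" "real \<tau> * \<eta> \<le> 1 / 2"
proof -
  show "0 \<le> \<eta>"
    unfolding \<eta>_def using mu_nonneg gamma_pos by simp
  have "\<gamma> * \<mu> \<le> \<gamma> * L"
    using mu_le_L gamma_pos by simp
  moreover have "\<gamma> * L \<le> \<gamma> * L * real \<tau>"
    using mult_left_mono[of 1 "real \<tau>" "\<gamma> * L"] tau_pos gamma_pos L_pos by simp
  ultimately show "\<eta> \<le> 1 / 8"
    unfolding \<eta>_def using gamma_L_tau by simp
  have "real \<tau> * \<eta> \<le> real \<tau> * (\<gamma> * L)"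
    unfolding \<eta>_def using \<open>\<gamma> * \<mu> \<le> \<gamma> * L\<close> \<open>0 \<le> \<eta>\<close> unfolding \<eta>_def by (intro mult_left_mono) auto
  then show "real \<tau> * \<eta> \<le> 1 / 2"
    using gamma_L_tau by (simp add: mult.commute)
qed

lemma eta_less_1: "\<eta> < 1"
  using eta_bounds by simp

lemma weighted_em_le:
  "3 * L * (\<Sum>k\<le>K. wgt \<eta> k * (LINT w|M. (norm (em k w))\<^sup>2))
    \<le> 1 / 4 * (\<Sum>k\<le>K. wgt \<eta> k * (LINT w|M. gap k w)) + \<gamma> * (3 * \<gamma> * real \<tau> * L * D1) * Wgt \<eta> K"
proof -
  define a where "a = 2 * L * (real \<tau> + \<omega> / real n)"
  define r where "r t = (LINT w|M. gap t w)" for t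
  define R where "R = (\<Sum>k\<le>K. wgt \<eta> k * r k)"
  have r: "0 \<le> r t" for t
    unfolding r_def by (intro Bochner_Integration.integral_nonneg gap_nonneg)
  have w: "0 \<le> wgt \<eta> k" for k
    using wgt_pos[OF eta_less_1] less_imp_le by blast
  have a: "0 \<le> a"
    unfolding a_def using L_pos omega_n by simp
  have R: "0 \<le> R"
    unfolding R_def using w r by (intro sum_nonneg mult_nonneg_nonneg)
  have "(\<Sum>k\<le>K. wgt \<eta> k * (LINT w|M. (norm (em k w))\<^sup>2))
      \<le> (\<Sum>k\<le>K. wgt \<eta> k * (\<gamma>\<^sup>2 * (\<Sum>t\<in>{k - \<tau>..<k}. a * r t + D1)))"
    using w em_second_moment[OF mu_nonneg] unfolding a_def r_def by (intro sum_mono mult_left_mono)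
  also have "\<dots> \<le> (\<Sum>k\<le>K. wgt \<eta> k * (\<gamma>\<^sup>2 * (a * (\<Sum>t\<in>{k - \<tau>..<k}. r t) + real \<tau> * D1)))"
  proof (intro sum_mono mult_left_mono w zero_le_power2)
    fix k
    have "real (card {k - \<tau>..<k}) * D1 \<le> real \<tau> * D1"
      using D1_nonneg by (intro mult_right_mono) auto
    then show "(\<Sum>t\<in>{k - \<tau>..<k}. a * r t + D1) \<le> a * (\<Sum>t\<in>{k - \<tau>..<k}. r t) + real \<tau> * D1"
      by (simp add: sum.distrib sum_distrib_left)
  qed
  also have "\<dots> = \<gamma>\<^sup>2 * (a * (\<Sum>k\<le>K. wgt \<eta> k * (\<Sum>t\<in>{k - \<tau>..<k}. r t)) + real \<tau> * D1 * Wgt \<eta> K)"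
  proof -
    have "wgt \<eta> k * (\<gamma>\<^sup>2 * (a * s + real \<tau> * D1)) = \<gamma>\<^sup>2 * a * (wgt \<eta> k * s) + \<gamma>\<^sup>2 * (real \<tau> * D1) * wgt \<eta> k" for k s
      by (simp add: algebra_simps)
    then show ?thesis
      by (simp only: sum.distrib sum_distrib_left[symmetric] Wgt_def[symmetric])
         (simp add: distrib_left mult.assoc)
  qed
  also have "\<dots> \<le> \<gamma>\<^sup>2 * (a * (2 * real \<tau> * R) + real \<tau> * D1 * Wgt \<eta> K)"
    unfolding R_def using a eta_bounds r
    by (intro mult_left_mono add_right_mono weighted_window_sum_le eta_less_1) auto
  finally have "3 * L * (\<Sum>k\<le>K. wgt \<eta> k * (LINT w|M. (norm (em k w))\<^sup>2))
      \<le> 3 * L * (\<gamma>\<^sup>2 * (a * (2 * real \<tau> * R) + real \<tau> * D1 * Wgt \<eta> K))"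
    using L_pos by (intro mult_left_mono) auto
  also have "\<dots> = 12 * ((\<gamma> * L)\<^sup>2 * (real \<tau> * (real \<tau> + \<omega> / real n))) * R
      + \<gamma> * (3 * \<gamma> * real \<tau> * L * D1) * Wgt \<eta> K"
    unfolding a_def by (simp add: power2_eq_square algebra_simps)
  also have "12 * ((\<gamma> * L)\<^sup>2 * (real \<tau> * (real \<tau> + \<omega> / real n))) * R \<le> 1 / 4 * R"
  proof (rule mult_right_mono[OF _ R])
    have "(\<gamma> * L)\<^sup>2 * (real \<tau> * (real \<tau> + \<omega> / real n)) \<le> (\<gamma> * L)\<^sup>2 * (real \<tau> * (real \<tau> + 1 + \<omega> / real n))"
      by (intro mult_left_mono) auto
    then show "12 * ((\<gamma> * L)\<^sup>2 * (real \<tau> * (real \<tau> + \<omega> / real n))) \<le> 1 / 4"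
      using step_delay by linarith
  qed
  finally show ?thesis
    unfolding R_def r_def by simp
qed

text \<open>
  The corrected iterate \<open>x - e\<close> performs an undelayed stochastic gradient step, taken with the
  gradient at \<open>x\<close>; the error made by this mismatch is what \<open>weighted_em_le\<close> controls.
\<close>

definition potential :: "nat \<Rightarrow> real" where "potential k = (LINT w|M. (norm (x k w - em k w - xs))\<^sup>2)"

text \<open>
  The constant \<open>3 * L\<close> is \<open>2 * L\<close> from Young's inequality, balanced so that \<open>grad_h_le\<close> turns the
  squared gradient into exactly one gap, plus \<open>\<mu> \<le> L\<close> from replacing the distance of \<open>z\<close> to the
  minimizer by that of \<open>z - u\<close>.
\<close>

lemma shifted_inner_le:
  "- 2 * ((z - u - xs) \<bullet> grad h z)
    \<le> - (h z - h xs) - \<mu> / 2 * (norm (z - u - xs))\<^sup>2 + 3 * L * (norm u)\<^sup>2"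
proof -
  have 1: "2 * (u \<bullet> grad h z) \<le> 2 * L * (norm u)\<^sup>2 + (h z - h xs)"
  proof -
    have "0 \<le> (norm ((2 * L) *\<^sub>R u - grad h z))\<^sup>2"
      by simp
    also have "\<dots> = 4 * (L * L) * (norm u)\<^sup>2 - 4 * L * (u \<bullet> grad h z) + (norm (grad h z))\<^sup>2"
      by (simp add: power2_norm_eq_inner inner_diff_left inner_diff_right inner_commute)
    also have "\<dots> \<le> 4 * (L * L) * (norm u)\<^sup>2 - 4 * L * (u \<bullet> grad h z) + 2 * L * (h z - h xs)"
      using grad_h_le[of z] by simp
    finally have "2 * L * (2 * (u \<bullet> grad h z)) \<le> 2 * L * (2 * L * (norm u)\<^sup>2 + (h z - h xs))"
      by (simp add: algebra_simps)
    then show ?thesis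
      using L_pos by simp
  qed
  have "(norm (z - u - xs))\<^sup>2 \<le> 2 * (norm (z - xs))\<^sup>2 + 2 * (norm u)\<^sup>2"
  proof -
    have "0 \<le> (norm (z - xs + u))\<^sup>2"
      by simp
    then show ?thesis
      by (simp add: power2_norm_eq_inner inner_diff_left inner_diff_right inner_add_left inner_add_right
          inner_commute)
  qed
  then have "\<mu> / 2 * (norm (z - u - xs))\<^sup>2 \<le> \<mu> / 2 * (2 * (norm (z - xs))\<^sup>2 + 2 * (norm u)\<^sup>2)"
    using mu_nonneg by (intro mult_left_mono) auto
  moreover have "\<mu> * (norm u)\<^sup>2 \<le> L * (norm u)\<^sup>2"
    using mu_le_L by (intro mult_right_mono) auto
  ultimately have 2: "- \<mu> * (norm (z - xs))\<^sup>2 \<le> - \<mu> / 2 * (norm (z - u - xs))\<^sup>2 + L * (norm u)\<^sup>2"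
    by (simp add: distrib_left)
  have "(z - u - xs) \<bullet> grad h z = grad h z \<bullet> (z - xs) - u \<bullet> grad h z"
    by (simp add: inner_diff_left inner_diff_right inner_commute)
  then show ?thesis
    using 1 2 qsc_inner[of z] by simp
qed

lemma descent_step:
  "\<gamma> / 2 * (LINT w|M. gap k w)
    \<le> (1 - \<eta>) * potential k - potential (Suc k) + 3 * L * \<gamma> * (LINT w|M. (norm (em k w))\<^sup>2) + \<gamma>\<^sup>2 * D1"
proof -
  define Z where "Z w = x k w - em k w - xs" for w
  have sqZ: "square_integrable M Z"
    unfolding Z_def[abs_def]
    by (intro square_integrable_diff square_integrable_x square_integrable_em square_integrable_const)
  have ZF: "Z \<in> borel_measurable (F k)"
    unfolding Z_def[abs_def] x_minus_em
    by (intro borel_measurable_diff borel_measurable_const borel_measurable_scaleR borel_measurable_sum gm_F) auto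
  have sq: "square_integrable M (\<lambda>w. (- \<gamma>) *\<^sub>R gm k w)"
    by (intro square_integrable_scaleR square_integrable_gm)
  have int: "integrable M (gap k)" "integrable M (\<lambda>w. (norm (Z w))\<^sup>2)" "integrable M (\<lambda>w. (norm (em k w))\<^sup>2)"
    "integrable M (\<lambda>w. Z w \<bullet> grad h (x k w))" "integrable M (\<lambda>w. Z w \<bullet> noise k w)"
    by (intro integrable_gap mu_nonneg square_integrable_norm sqZ square_integrable_em integrable_inner
        square_integrable_grad_h square_integrable_noise)+
  have "x (Suc k) w - em (Suc k) w - xs = Z w + (- \<gamma>) *\<^sub>R gm k w" for w
    unfolding Z_def x_minus_em by (simp add: scaleR_add_right)
  then have "potential (Suc k) = (LINT w|M. (norm (Z w + (- \<gamma>) *\<^sub>R gm k w))\<^sup>2)"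
    unfolding potential_def by simp
  also have "\<dots> = (LINT w|M. (norm (Z w))\<^sup>2) + 2 * (LINT w|M. Z w \<bullet> ((- \<gamma>) *\<^sub>R gm k w))
      + (LINT w|M. (norm ((- \<gamma>) *\<^sub>R gm k w))\<^sup>2)"
    by (rule integral_norm_add_power2[OF sqZ sq])
  also have "(LINT w|M. Z w \<bullet> ((- \<gamma>) *\<^sub>R gm k w)) = - \<gamma> * (LINT w|M. Z w \<bullet> grad h (x k w) + Z w \<bullet> noise k w)"
    unfolding gm_eq inner_scaleR_right inner_add_right by (rule integral_mult_right_zero)
  also have "(LINT w|M. Z w \<bullet> grad h (x k w) + Z w \<bullet> noise k w) = (LINT w|M. Z w \<bullet> grad h (x k w))"
    using centered_orthogonal[OF centered_noise subalgebra_F square_integrable_noise ZF sqZ] int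
    by (simp add: inner_commute)
  also have "(LINT w|M. (norm ((- \<gamma>) *\<^sub>R gm k w))\<^sup>2) = \<gamma>\<^sup>2 * (LINT w|M. (norm (gm k w))\<^sup>2)"
    by (simp add: power_mult_distrib)
  finally have potential: "potential (Suc k) = potential k + \<gamma> * (- 2 * (LINT w|M. Z w \<bullet> grad h (x k w))) + \<gamma>\<^sup>2 * (LINT w|M. (norm (gm k w))\<^sup>2)"
    unfolding potential_def Z_def by simp
  have "- 2 * (LINT w|M. Z w \<bullet> grad h (x k w)) = (LINT w|M. - 2 * (Z w \<bullet> grad h (x k w)))"
    by (rule integral_mult_right_zero[symmetric])
  also have "\<dots> \<le> (LINT w|M. - gap k w - \<mu> / 2 * (norm (Z w))\<^sup>2 + 3 * L * (norm (em k w))\<^sup>2)"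
  proof (rule integral_mono)
    show "integrable M (\<lambda>w. - 2 * (Z w \<bullet> grad h (x k w)))"
      "integrable M (\<lambda>w. - gap k w - \<mu> / 2 * (norm (Z w))\<^sup>2 + 3 * L * (norm (em k w))\<^sup>2)"
      using int by auto
    show "- 2 * (Z w \<bullet> grad h (x k w)) \<le> - gap k w - \<mu> / 2 * (norm (Z w))\<^sup>2 + 3 * L * (norm (em k w))\<^sup>2" for w
      unfolding Z_def gap_def by (rule shifted_inner_le)
  qed
  also have "\<dots> = - (LINT w|M. gap k w) - \<mu> / 2 * potential k + 3 * L * (LINT w|M. (norm (em k w))\<^sup>2)"
    using int unfolding potential_def Z_def by simp
  finally have "\<gamma> * (- 2 * (LINT w|M. Z w \<bullet> grad h (x k w)))
      \<le> \<gamma> * (- (LINT w|M. gap k w) - \<mu> / 2 * potential k + 3 * L * (LINT w|M. (norm (em k w))\<^sup>2))"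
    using gamma_pos by (intro mult_left_mono) auto
  then have "\<gamma> * (- 2 * (LINT w|M. Z w \<bullet> grad h (x k w)))
      \<le> - \<gamma> * (LINT w|M. gap k w) - \<gamma> * \<mu> / 2 * potential k + 3 * L * \<gamma> * (LINT w|M. (norm (em k w))\<^sup>2)"
    by (simp add: algebra_simps)
  moreover have "\<gamma>\<^sup>2 * (LINT w|M. (norm (gm k w))\<^sup>2)
      \<le> \<gamma>\<^sup>2 * (2 * (L * (1 + \<omega> / real n)) * (LINT w|M. gap k w)) + \<gamma>\<^sup>2 * D1"
    unfolding distrib_left[symmetric] by (intro mult_left_mono expected_gm_le mu_nonneg) simp
  moreover have "\<gamma>\<^sup>2 * (2 * (L * (1 + \<omega> / real n)) * (LINT w|M. gap k w)) \<le> \<gamma> / 2 * (LINT w|M. gap k w)"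
  proof -
    have "(\<gamma> * (4 * L * (1 + \<omega> / real n))) * (\<gamma> / 2 * (LINT w|M. gap k w)) \<le> 1 * (\<gamma> / 2 * (LINT w|M. gap k w))"
      using gamma_pos by (intro mult_right_mono step_smooth mult_nonneg_nonneg
          Bochner_Integration.integral_nonneg gap_nonneg) auto
    then show ?thesis
      by (simp add: power2_eq_square algebra_simps)
  qed
  moreover have "(1 - \<eta>) * potential k = potential k - \<gamma> * \<mu> / 2 * potential k"
    unfolding \<eta>_def by (simp add: left_diff_distrib)
  ultimately show ?thesis
    unfolding potential by linarith
qed

lemma weighted_gap_le:
  "\<gamma> / 4 * (\<Sum>k\<le>K. wgt \<eta> k * (LINT w|M. gap k w))
    \<le> (norm (x0 - xs))\<^sup>2 + \<gamma>\<^sup>2 * (D1 + 3 * \<gamma> * real \<tau> * L * D1) * Wgt \<eta> K"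
proof -
  define r where "r k = (LINT w|M. gap k w)" for k
  define E where "E k = (LINT w|M. (norm (em k w))\<^sup>2)" for k
  have "(\<Sum>k\<le>K. wgt \<eta> k * (\<gamma> / 2 * r k - 3 * L * \<gamma> * E k - \<gamma>\<^sup>2 * D1)) \<le> potential 0"
  proof (rule weighted_contraction_sum_le[OF eta_less_1])
    show "0 \<le> potential k" for k
      unfolding potential_def by (intro Bochner_Integration.integral_nonneg) simp
    show "\<gamma> / 2 * r k - 3 * L * \<gamma> * E k - \<gamma>\<^sup>2 * D1 \<le> (1 - \<eta>) * potential k - potential (Suc k)" for k
      using descent_step[of k] unfolding r_def E_def by linarith
  qed
  also have "potential 0 = (norm (x0 - xs))\<^sup>2"
    unfolding potential_def x_minus_em by (simp add: prob_space)
  also have "(\<Sum>k\<le>K. wgt \<eta> k * (\<gamma> / 2 * r k - 3 * L * \<gamma> * E k - \<gamma>\<^sup>2 * D1))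
      = \<gamma> / 2 * (\<Sum>k\<le>K. wgt \<eta> k * r k) - \<gamma> * (3 * L * (\<Sum>k\<le>K. wgt \<eta> k * E k)) - \<gamma>\<^sup>2 * D1 * Wgt \<eta> K"
    unfolding Wgt_def sum_distrib_left sum_subtractf[symmetric]
    by (intro sum.cong) (auto simp: algebra_simps)
  finally have "\<gamma> / 2 * (\<Sum>k\<le>K. wgt \<eta> k * r k)
      \<le> (norm (x0 - xs))\<^sup>2 + \<gamma> * (3 * L * (\<Sum>k\<le>K. wgt \<eta> k * E k)) + \<gamma>\<^sup>2 * D1 * Wgt \<eta> K"
    by simp
  moreover have "\<gamma> * (3 * L * (\<Sum>k\<le>K. wgt \<eta> k * E k))
      \<le> \<gamma> * (1 / 4 * (\<Sum>k\<le>K. wgt \<eta> k * r k) + \<gamma> * (3 * \<gamma> * real \<tau> * L * D1) * Wgt \<eta> K)"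
    using gamma_pos weighted_em_le[of K] unfolding r_def E_def by (intro mult_left_mono) auto
  ultimately show ?thesis
    unfolding r_def[symmetric] by (simp add: power2_eq_square algebra_simps)
qed

lemma weighted_avg_gap:
  fixes K :: nat
  defines "gbar \<equiv> \<lambda>w. h (weighted_avg \<eta> x K w) - h xs"
  shows integrable_weighted_avg_gap: "integrable M gbar"
    and expected_weighted_avg_gap_le: "(LINT w|M. gbar w)
      \<le> 4 * (norm (x0 - xs))\<^sup>2 / (\<gamma> * Wgt \<eta> K) + 4 * \<gamma> * (D1 + 3 * \<gamma> * real \<tau> * L * D1)"
proof -
  define W where "W = Wgt \<eta> K"
  have W: "0 < W"
    unfolding W_def by (rule Wgt_pos[OF eta_less_1])
  define B where "B w = (\<Sum>k\<le>K. wgt \<eta> k / W * gap k w)" for w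
  have intB: "integrable M B"
    unfolding B_def[abs_def] using integrable_gap[OF mu_nonneg] by simp
  have one: "(\<Sum>k\<le>K. wgt \<eta> k / W) = 1"
    using W unfolding W_def Wgt_def by (simp add: sum_divide_distrib[symmetric])
  have le: "gbar w \<le> B w" for w
  proof -
    have "weighted_avg \<eta> x K w = (\<Sum>k\<le>K. (wgt \<eta> k / W) *\<^sub>R x k w)"
      unfolding weighted_avg_def W_def by (simp add: scaleR_sum_right)
    moreover have "h (\<Sum>k\<le>K. (wgt \<eta> k / W) *\<^sub>R x k w) \<le> (\<Sum>k\<le>K. wgt \<eta> k / W * h (x k w))"
    proof (rule convex_on_sum[where S = "{..K}" and C = UNIV and f = h
          and a = "\<lambda>k. wgt \<eta> k / W" and y = "\<lambda>k. x k w"])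
      show "convex_on UNIV h" by (rule convex_h)
      show "(\<Sum>k\<le>K. wgt \<eta> k / W) = 1" by (rule one)
      show "0 \<le> wgt \<eta> k / W" for k
        using W wgt_pos[OF eta_less_1, of k] by simp
    qed auto
    ultimately have "h (weighted_avg \<eta> x K w) \<le> (\<Sum>k\<le>K. wgt \<eta> k / W * h (x k w))"
      by simp
    also have "\<dots> = B w + h xs"
    proof -
      have "B w = (\<Sum>k\<le>K. wgt \<eta> k / W * h (x k w)) - (\<Sum>k\<le>K. wgt \<eta> k / W) * h xs"
        unfolding B_def gap_def by (simp add: right_diff_distrib sum_subtractf sum_distrib_right)
      then show ?thesis using one by simp
    qed
    finally show ?thesis unfolding gbar_def by simp
  qed
  have meas: "gbar \<in> borel_measurable M"
    unfolding gbar_def weighted_avg_def by measurable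
  show int: "integrable M gbar"
  proof (rule Bochner_Integration.integrable_bound[OF intB meas])
    have "0 \<le> gbar w" for w
      unfolding gbar_def using minimum by simp
    then have "norm (gbar w) \<le> norm (B w)" for w
      using le[of w] by (smt (verit) real_norm_def)
    then show "AE w in M. norm (gbar w) \<le> norm (B w)"
      by simp
  qed
  have "(LINT w|M. gbar w) \<le> (LINT w|M. B w)"
    by (intro integral_mono int intB le)
  also have "\<dots> = (\<Sum>k\<le>K. wgt \<eta> k * (LINT w|M. gap k w)) / W"
    unfolding B_def using integrable_gap[OF mu_nonneg]
    by (simp add: Bochner_Integration.integral_sum sum_divide_distrib)
  also have "\<dots> \<le> (4 / \<gamma> * ((norm (x0 - xs))\<^sup>2 + \<gamma>\<^sup>2 * (D1 + 3 * \<gamma> * real \<tau> * L * D1) * W)) / W"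
    using weighted_gap_le[of K] W gamma_pos unfolding W_def[symmetric]
    by (intro divide_right_mono) (auto simp: field_simps)
  also have "\<dots> = 4 * (norm (x0 - xs))\<^sup>2 / (\<gamma> * W) + 4 * \<gamma> * (D1 + 3 * \<gamma> * real \<tau> * L * D1)"
    using W gamma_pos by (simp add: field_simps power2_eq_square)
  finally show "(LINT w|M. gbar w)
      \<le> 4 * (norm (x0 - xs))\<^sup>2 / (\<gamma> * Wgt \<eta> K) + 4 * \<gamma> * (D1 + 3 * \<gamma> * real \<tau> * L * D1)"
    unfolding W_def .
qed

end

theorem theoremK3:
  fixes f :: "nat \<Rightarrow> 'a::euclidean_space \<Rightarrow> real"
    and Q :: "'a \<Rightarrow> 's \<Rightarrow> 'a"
    and M :: "'w measure" and N :: "'z measure" and S :: "'s measure"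
    and n \<tau> :: nat
    and L \<mu> \<omega> \<gamma> D D1' D3 :: real
    and Dw :: "nat \<Rightarrow> real"
    and xs x0 :: 'a
    and smp :: "nat \<Rightarrow> nat \<Rightarrow> 'w \<Rightarrow> 'z"
    and seed :: "nat \<Rightarrow> nat \<Rightarrow> 'w \<Rightarrow> 's"
    and ghat g e :: "nat \<Rightarrow> nat \<Rightarrow> 'w \<Rightarrow> 'a"
    and x :: "nat \<Rightarrow> 'w \<Rightarrow> 'a"
    and c :: par_consts
  assumes "n \<ge> 1" and "\<tau> \<ge> 1"
    and "\<And>i. i < n \<Longrightarrow> convex_on UNIV (f i)"
    and "\<And>i. i < n \<Longrightarrow> L_smooth L (f i)"
    and "\<mu> \<ge> 0" and "quasi_strongly_convex \<mu> (mean_fun n f) xs"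
    and "\<omega> > 0" and "quantization_operator S \<omega> Q"
    and "\<And>i. i < n \<Longrightarrow> Dw i \<ge> 0"
    and "D_QSGDstar M N S n f xs Q Dw \<gamma> \<tau> x0 smp seed ghat g x e"
    and "0 < \<gamma>"
    and "\<gamma> \<le> min (1 / (4 * L * (1 + \<omega> / real n)))
                  (1 / (8 * L * sqrt (real \<tau> * (real \<tau> + 1 + \<omega> / real n))))"
    and "D = (1 / real n) * (\<Sum>i<n. Dw i)"
    and "D1' = (\<omega> + 1) * D / real n"
    and "D3 = 3 * \<gamma> * real \<tau> * L * (\<omega> + 1) * D / real n"
    and "c = \<lparr> cA = L * (1 + \<omega> / real n), cB1 = 0, cB2 = 0, cD1 = D1', cC1 = 0, cC2 = 0,
               cG = 0, cD2 = 0, crho1 = 1, crho2 = 1, cF1 = 0, cF2 = 0, cD3 = D3 \<rparr>"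
  shows "parametric_assumption M (history M N S n smp seed x) (mean_fun n f) xs L \<mu> \<gamma> x
           (\<lambda>k w. (1 / real n) *\<^sub>R (\<Sum>i<n. g i k w)) (\<lambda>k w. (1 / real n) *\<^sub>R (\<Sum>i<n. e i k w))
           (\<lambda>k w. 0) (\<lambda>k w. 0) c \<and>
         (\<forall>K. let xbar = weighted_avg (par_eta c \<gamma> \<mu>) x K;
                  gap = (\<lambda>w. mean_fun n f (xbar w) - mean_fun n f xs)
              in integrable M gap \<and>
                 (\<mu> > 0 \<longrightarrow> (LINT w|M. gap w)
                    \<le> (1 - \<gamma> * \<mu> / 2) ^ K * (4 * (norm (x0 - xs))\<^sup>2 / \<gamma>) + 4 * \<gamma> * (D1' + D3)) \<and>
                 (\<mu> = 0 \<and> K > 0 \<longrightarrow> (LINT w|M. gap w)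
                    \<le> 4 * (norm (x0 - xs))\<^sup>2 / (\<gamma> * real K) + 4 * \<gamma> * (D1' + D3)))"
proof -
  have L: "L > 0"
  proof -
    have "0 \<le> L"
      using assms(1,4) L_smooth_nonneg[of L "f 0"] by simp
    \<comment> \<open>For \<open>L = 0\<close> the step size bounds read \<open>1 / 0 = 0\<close> and contradict \<open>\<gamma> > 0\<close>.\<close>
    moreover have "L \<noteq> 0"
      using assms(11,12) by auto
    ultimately show ?thesis by simp
  qed
  have om: "0 \<le> \<omega> / real n"
    using assms(7) by simp
  interpret prob_space M
    using assms(10) unfolding D_QSGDstar_def by blast
  interpret dqsgd_stepsize f n L \<mu> xs M Q N S \<tau> \<omega> \<gamma> Dw x0 smp seed ghat g e x
  proof unfold_locales
    have "\<gamma> \<le> 1 / (4 * L * (1 + \<omega> / real n))"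
      using assms(12) by simp
    moreover have "0 < 4 * L * (1 + \<omega> / real n)"
      using L om by simp
    ultimately show "\<gamma> * (4 * L * (1 + \<omega> / real n)) \<le> 1"
      by (simp only: pos_le_divide_eq)
    define X where "X = real \<tau> * (real \<tau> + 1 + \<omega> / real n)"
    have X: "0 < X"
      unfolding X_def using assms(2) om by (intro mult_pos_pos) auto
    have "\<gamma> \<le> 1 / (8 * L * sqrt X)"
      using assms(12) unfolding X_def by simp
    then have "\<gamma> * (8 * L * sqrt X) \<le> 1"
      using L X by (subst (asm) pos_le_divide_eq) auto
    then have "(\<gamma> * (8 * L * sqrt X))\<^sup>2 \<le> 1"
      using assms(11) L X by (intro power_le_one) auto
    then show "(\<gamma> * L)\<^sup>2 * (64 * (real \<tau> * (real \<tau> + 1 + \<omega> / real n))) \<le> 1"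
      using X unfolding X_def[symmetric] by (simp add: power_mult_distrib algebra_simps)
  qed (use assms L in auto)
  have D1': "D1' = D1"
    unfolding assms(14) assms(13) D1_def ..
  have D3: "D3 = 3 * \<gamma> * real \<tau> * L * D1"
    unfolding assms(15) assms(13) D1_def by simp
  have par_eta: "par_eta c \<gamma> \<mu> = \<eta>"
    using eta_bounds(2) unfolding par_eta_def assms(16) \<eta>_def by (simp add: min_def)
  have par: "parametric_assumption M F (mean_fun n f) xs L \<mu> \<gamma> x gm em (\<lambda>k w. 0) (\<lambda>k w. 0) c"
    unfolding parametric_assumption_def Let_def par_eta
  proof (intro conjI allI AE_I2)
    fix k
    show "has_cond_exp M (F k) (gm k) (\<lambda>w. grad (mean_fun n f) (x k w))"
      by (rule has_cond_exp_gm)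
    have "cond_exp_le M (F k) (\<lambda>w. (norm (gm k w))\<^sup>2) (\<lambda>w. 2 * (L * (1 + \<omega> / real n)) * gap k w + D1)"
      using gap_F integrable_gap[OF mu_nonneg]
      by (intro cond_exp_leI subalgebra_F square_integrable_norm square_integrable_gm gm_second_moment
          mu_nonneg) auto
    then show "cond_exp_le M (F k) (\<lambda>w. (norm (gm k w))\<^sup>2)
        (\<lambda>w. 2 * cA c * (mean_fun n f (x k w) - mean_fun n f xs) + cB1 c * 0\<^sup>2 + cB2 c * 0\<^sup>2 + cD1 c)"
      unfolding assms(16) D1' gap_def by simp
    have zero: "cond_exp_le M (F k) (\<lambda>w. 0) (\<lambda>w. 0)"
      by (intro cond_exp_leI subalgebra_F) auto
    then show "cond_exp_le M (F k) (\<lambda>w. 0\<^sup>2)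
        (\<lambda>w. (1 - crho1 c) * 0\<^sup>2 + 2 * cC1 c * (mean_fun n f (x k w) - mean_fun n f xs)
             + cG c * crho1 c * 0\<^sup>2 + cD2 c)"
      unfolding assms(16) by simp
    from zero show "cond_exp_le M (F k) (\<lambda>w. 0\<^sup>2)
        (\<lambda>w. (1 - crho2 c) * 0\<^sup>2 + 2 * cC2 c * (mean_fun n f (x k w) - mean_fun n f xs))"
      unfolding assms(16) by simp
    show "integrable M (\<lambda>w. (norm (em k w))\<^sup>2)"
      by (intro square_integrable_norm square_integrable_em)
    show "integrable M (\<lambda>w. mean_fun n f (x k w) - mean_fun n f xs)"
      using integrable_gap[OF mu_nonneg, of k] unfolding gap_def[abs_def] .
    show "3 * L * (\<Sum>k\<le>k. wgt \<eta> k * (LINT w|M. (norm (em k w))\<^sup>2))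
        \<le> 1 / 4 * (\<Sum>k\<le>k. wgt \<eta> k * (LINT w|M. mean_fun n f (x k w) - mean_fun n f xs))
          + cF1 c * 0\<^sup>2 + cF2 c * 0\<^sup>2 + \<gamma> * cD3 c * Wgt \<eta> k"
      using weighted_em_le[of k] unfolding assms(16) D3 gap_def by simp
  qed
  have rate_pos: "4 * (norm (x0 - xs))\<^sup>2 / (\<gamma> * Wgt \<eta> K)
      \<le> (1 - \<gamma> * \<mu> / 2) ^ K * (4 * (norm (x0 - xs))\<^sup>2 / \<gamma>)" for K
  proof -
    have "wgt \<eta> K \<le> Wgt \<eta> K"
      unfolding Wgt_def using wgt_pos[OF eta_less_1]
      by (intro member_le_sum) (auto intro: less_imp_le)
    moreover have "1 / (1 - \<eta>) ^ K \<le> wgt \<eta> K"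
      unfolding wgt_def using eta_bounds eta_less_1
      by (intro divide_left_mono power_decreasing mult_pos_pos zero_less_power) auto
    ultimately have "1 / (1 - \<eta>) ^ K \<le> Wgt \<eta> K"
      by linarith
    then have "1 \<le> (1 - \<eta>) ^ K * Wgt \<eta> K"
      using eta_less_1 by (simp add: field_simps)
    then have "1 / Wgt \<eta> K \<le> (1 - \<eta>) ^ K"
      using Wgt_pos[OF eta_less_1, of K] by (simp add: field_simps)
    then have "4 * (norm (x0 - xs))\<^sup>2 / \<gamma> * (1 / Wgt \<eta> K) \<le> 4 * (norm (x0 - xs))\<^sup>2 / \<gamma> * (1 - \<eta>) ^ K"
      using gamma_pos by (intro mult_left_mono) auto
    then show ?thesis
      unfolding \<eta>_def by (simp add: mult.commute)
  qed
  have rate_0: "4 * (norm (x0 - xs))\<^sup>2 / (\<gamma> * Wgt \<eta> K) \<le> 4 * (norm (x0 - xs))\<^sup>2 / (\<gamma> * real K)"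
    if "\<mu> = 0" "K > 0" for K
  proof -
    have "Wgt \<eta> K = real K + 1"
      using that unfolding Wgt_def wgt_def \<eta>_def by simp
    then show ?thesis
      using that gamma_pos by (intro divide_left_mono mult_pos_pos mult_left_mono) auto
  qed
  show ?thesis
    unfolding par_eta Let_def gm_def[symmetric] em_def[symmetric]
  proof (intro conjI allI impI)
    show "parametric_assumption M F (mean_fun n f) xs L \<mu> \<gamma> x gm em (\<lambda>k w. 0) (\<lambda>k w. 0) c"
      by (rule par)
    fix K
    show "integrable M (\<lambda>w. mean_fun n f (weighted_avg \<eta> x K w) - mean_fun n f xs)"
      by (rule integrable_weighted_avg_gap)
    show "(LINT w|M. mean_fun n f (weighted_avg \<eta> x K w) - mean_fun n f xs)
        \<le> (1 - \<gamma> * \<mu> / 2) ^ K * (4 * (norm (x0 - xs))\<^sup>2 / \<gamma>) + 4 * \<gamma> * (D1' + D3)"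
      using expected_weighted_avg_gap_le[of K] rate_pos[of K] unfolding D1' D3 by linarith
    assume "\<mu> = 0 \<and> K > 0"
    then show "(LINT w|M. mean_fun n f (weighted_avg \<eta> x K w) - mean_fun n f xs)
        \<le> 4 * (norm (x0 - xs))\<^sup>2 / (\<gamma> * real K) + 4 * \<gamma> * (D1' + D3)"
      using expected_weighted_avg_gap_le[of K] rate_0[of K] unfolding D1' D3 by linarith
  qed
qed

end
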